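(* Let $\lambda\ge0$, $T>0$, let $g$ and $u_0$ satisfy hypotheses (H) of the context, and let $u$ be a constructed weak solution (as defined in the context) of $$\partial_t u=\rho_\lambda u\,\partial_x^2u+\rho_\lambda g u\ \text{ in }(0,T)\times\Omega,\qquad u(t,0)=0,\qquad u(0,\cdot)=u_0 .$$ Put $$\theta=\max\Big(\operatorname{ess\,sup}_\Omega(-\rho_\lambda g),\,0\Big),\qquad K_\theta(t)=\begin{cases}t,&\theta=0,\\ \dfrac1\theta\,\dfrac{e^{\theta t}-1}{e^{\theta t}},&\theta>0.\end{cases}$$ Then, in the sense of distributions in $Q_T$, $$\partial_tu\ge-\frac{u}{K_\theta(t)} .$$
   Context: $\Omega=(0,\infty)$, $Q_T=(0,T)\times\Omega$, $\rho_\lambda(x)=x^{1/2}(x+\lambda)(x+2\lambda)^{1/2}$ (so $\rho_0(x)=x^2$), $d\nu_\lambda=\rho_\lambda(x)^{-1}dx$. (H): $\rho_\lambda g\in L^\infty(\Omega)$; $u_0\ge0$; if $\lambda=0$, $u_0\in L^\delta(\Omega;d\nu_0)\cap L^3(\Omega;d\nu_0)$ for some $\delta\in(0,1)$; if $\lambda>0$, $u_0\in L^1(\Omega;d\nu_\lambda)\cap L^3(\Omega;d\nu_\lambda)$ (then $\nu_\lambda$ is finite, $u_0\in L^\delta(d\nu_\lambda)$ for all $\delta\in(0,1)$, and any such $\delta$ may be fixed). Weak solution: a nonnegative $u:Q_T\to\mathbb R$ with $u^2\in L^{3/2}(0,T;V_0^{3/2}(\Omega))$, $\partial_xu^2\in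 L^2(Q_T)$, $\partial_xu\in L^2_{loc}(Q_T)$, such that for all $\phi\in C_c^\infty([0,T)\times\Omega)$ $$-\int_{Q_T}u\,\partial_t\phi\,dt\,d\nu_\lambda+\int_{Q_T}\partial_x\Big(\frac{u^2}{2}\Big)\partial_x\phi+\int_{Q_T}|\partial_xu|^2\phi=\int_\Omega u_0\,\phi(0,\cdot)\,d\nu_\lambda+\int_{Q_T}\phi u g ,$$ where $V_0^p(\Omega)$ is the closure of $C_c^\infty(\Omega)$ under $\|f\|_{L^p(\Omega;d\nu_\lambda)}+\|\partial_xf\|_{L^2(\Omega)}$. Regularized solutions: for each $n\in\mathbb N$ choose $\Omega_n=(a_n,b_n)$ with $a_{n+1}<a_n$, $b_n<b_{n+1}$, $a_n\to0$, $b_n\to\infty$, $\frac1n\nu_\lambda(\Omega_n)\to0$; $r_n>0$ with $r_n\to0$, $r_nn^\delta\to\infty$; and data with $\rho_\lambda g_n\in C_c^\infty(\Omega_n)$, $0\le u_{0,n}\in C_c^{2+\beta}(\Omega_n)$ for some $\beta\in(0,1)$, $u_{0,n}\to u_0$ in $L^p(\Omega;d\nu_\lambda)$ for $p\in[\delta,3]$, $\rho_\lambda g_n\to\rho_\lambda g$ in $L^p_{loc}(\Omega)$ and a.e., $\operatorname{ess\,inf}_{\Omega_n}\rho_\lambda g_n\ge\min(\operatorname{ess\,inf}_\Omega\rho_\lambda g,0)$, $\|\rho_\lambda g_n\|_{L^\infty}\le\|\rho_\lambda g\|_{L^\infty}$, and $\operatorname{supp}u_{0,n}\cup\operatorname{supp}(\rho_\lambda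 g_n)\subset[a_n+r_n,b_n-r_n]$; any such choice of $(\Omega_n,r_n,u_{0,n},g_n)_{n\in\mathbb N}$ is called admissible regularized data. Let $u_n\in C^{1+\beta/2,2+\beta}([0,T]\times\overline{\Omega_n})$ be the unique classical solution of $\partial_tu_n=\rho_\lambda(u_n+\frac1n)\partial_x^2u_n+\rho_\lambda g_n(u_n+\frac1n)$ on $(0,T)\times\Omega_n$, $u_n(0,\cdot)=u_{0,n}$, $u_n(t,a_n)=u_n(t,b_n)=0$, extended by zero to $Q_T$. Constructed weak solution: a weak solution $u$ with $\partial_xu\in L^2(Q_T)$, $u\in L^\infty(0,T;L^p(\Omega;d\nu_\lambda))$ for $p\in[1,3]$ (and $p=\delta$ if $\lambda=0$), which, for some choice of admissible regularized data $(\Omega_n,r_n,u_{0,n},g_n)_{n\in\mathbb N}$, is the limit of a subsequence of the corresponding regularized solutions $(u_n)$ in the senses: $u_n\to u$ in $L^q_{loc}(Q_T;dt\times d\nu_\lambda)$ for all $q\in(\delta,3)$ and a.e.; $\partial_xu_n\rightharpoonup\partial_xu$ and $\partial_xu_n^2\rightharpoonup\partial_xu^2$ weakly in $L^2(Q_T)$; $\partial_xu_n\to\partial_xu$ in $L^2_{loc}(Q_T)$ and a.e. *)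

theory Defs
  imports "HOL-Analysis.Analysis" "HOL-Probability.Essential_Supremum"
begin

section \<open>Smooth functions with compact support\<close>

primrec Ck_on :: "nat \<Rightarrow> ('a::real_normed_vector \<Rightarrow> real) \<Rightarrow> 'a set \<Rightarrow> bool" where
  "Ck_on 0 f S \<longleftrightarrow> continuous_on S f"
| "Ck_on (Suc k) f S \<longleftrightarrow>
     (\<forall>x\<in>S. f differentiable (at x)) \<and> (\<forall>v. Ck_on k (\<lambda>x. frechet_derivative f (at x) v) S)"

definition smooth_on :: "'a::real_normed_vector set \<Rightarrow> ('a \<Rightarrow> real) \<Rightarrow> bool" where
  "smooth_on S f \<longleftrightarrow> (\<forall>k. Ck_on k f S)"

text \<open>
  The set \<open>S\<close> need not be open: for \<open>S = [0,T) \<times> \<Omega>\<close>, smoothness up to \<open>t = 0\<close> means that the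
  function is smooth on an open neighbourhood of \<open>S\<close>, and the support, taken inside \<open>S\<close>, may
  touch \<open>t = 0\<close>. For open \<open>S\<close> the neighbourhood can be taken to be \<open>S\<close> itself.
\<close>
definition Cc_infty :: "'a::real_normed_vector set \<Rightarrow> ('a \<Rightarrow> real) set" where
  "Cc_infty S = {f. (\<exists>U. open U \<and> S \<subseteq> U \<and> smooth_on U f) \<and>
                    (\<exists>K. compact K \<and> K \<subseteq> S \<and> (\<forall>x\<in>S - K. f x = 0))}"


section \<open>Lebesgue spaces\<close>

definition Lp :: "real \<Rightarrow> 'a measure \<Rightarrow> ('a \<Rightarrow> real) set" where
  "Lp p M = {f \<in> borel_measurable M. integrable M (\<lambda>x. \<bar>f x\<bar> powr p)}"

text \<open>Only a quasi-norm for \<open>p < 1\<close>; meaningful only on \<open>Lp p M\<close>.\<close>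
definition Lp_norm :: "real \<Rightarrow> 'a measure \<Rightarrow> ('a \<Rightarrow> real) \<Rightarrow> real" where
  "Lp_norm p M f = (LINT x|M. \<bar>f x\<bar> powr p) powr (1 / p)"

definition Lp_loc :: "real \<Rightarrow> 'a::topological_space measure \<Rightarrow> ('a \<Rightarrow> real) set" where
  "Lp_loc p M = {f. \<forall>K. compact K \<and> K \<subseteq> space M \<longrightarrow> f \<in> Lp p (restrict_space M K)}"

definition Lp_tendsto ::
  "real \<Rightarrow> 'a measure \<Rightarrow> (nat \<Rightarrow> 'a \<Rightarrow> real) \<Rightarrow> ('a \<Rightarrow> real) \<Rightarrow> bool" where
  "Lp_tendsto p M f h \<longleftrightarrow> h \<in> Lp p M \<and> (\<forall>\<^sub>F n in sequentially. f n \<in> Lp p M) \<and>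
     (\<lambda>n. Lp_norm p M (\<lambda>x. f n x - h x)) \<longlonglongrightarrow> 0"

definition Lp_loc_tendsto ::
  "real \<Rightarrow> 'a::topological_space measure \<Rightarrow> (nat \<Rightarrow> 'a \<Rightarrow> real) \<Rightarrow> ('a \<Rightarrow> real) \<Rightarrow> bool" where
  "Lp_loc_tendsto p M f h \<longleftrightarrow>
     (\<forall>K. compact K \<and> K \<subseteq> space M \<longrightarrow> Lp_tendsto p (restrict_space M K) f h)"

definition weak_L2_tendsto ::
  "'a measure \<Rightarrow> (nat \<Rightarrow> 'a \<Rightarrow> real) \<Rightarrow> ('a \<Rightarrow> real) \<Rightarrow> bool" where
  "weak_L2_tendsto M f h \<longleftrightarrow> h \<in> Lp 2 M \<and> (\<forall>\<^sub>F n in sequentially. f n \<in> Lp 2 M) \<and>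
     (\<forall>\<psi>\<in>Lp 2 M. (\<lambda>n. LINT x|M. f n x * \<psi> x) \<longlonglongrightarrow> (LINT x|M. h x * \<psi> x))"

definition Linf_norm :: "'a measure \<Rightarrow> ('a \<Rightarrow> real) \<Rightarrow> ereal" where
  "Linf_norm M f = esssup M (\<lambda>x. ereal \<bar>f x\<bar>)"

definition Linf :: "'a measure \<Rightarrow> ('a \<Rightarrow> real) set" where
  "Linf M = {f \<in> borel_measurable M. Linf_norm M f < \<infinity>}"

definition essinf :: "'a measure \<Rightarrow> ('a \<Rightarrow> ereal) \<Rightarrow> ereal" where
  "essinf M f = - esssup M (\<lambda>x. - f x)"

text \<open>
  Bochner spaces of functions of \<open>t\<close> with values in a space \<open>X\<close> of real functions carrying the
  (quasi-)norm \<open>N\<close>. Elements of \<open>X\<close> are functions rather than equivalence classes.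
\<close>
definition strongly_measurable ::
  "'t measure \<Rightarrow> ('x \<Rightarrow> real) set \<Rightarrow> (('x \<Rightarrow> real) \<Rightarrow> real) \<Rightarrow> ('t \<Rightarrow> 'x \<Rightarrow> real) \<Rightarrow> bool" where
  "strongly_measurable M X N F \<longleftrightarrow> (AE t in M. F t \<in> X) \<and>
     (\<exists>s. (\<forall>k. simple_function M (s k) \<and> (\<forall>t\<in>space M. s k t \<in> X)) \<and>
          (AE t in M. (\<lambda>k::nat. N (\<lambda>x. F t x - s k t x)) \<longlonglongrightarrow> 0))"

definition bochner_Lp ::
  "real \<Rightarrow> 't measure \<Rightarrow> ('x \<Rightarrow> real) set \<Rightarrow> (('x \<Rightarrow> real) \<Rightarrow> real) \<Rightarrow> ('t \<Rightarrow> 'x \<Rightarrow> real) set" where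
  "bochner_Lp q M X N = {F. strongly_measurable M X N F \<and> (\<lambda>t. N (F t)) \<in> Lp q M}"

definition bochner_Linf ::
  "'t measure \<Rightarrow> ('x \<Rightarrow> real) set \<Rightarrow> (('x \<Rightarrow> real) \<Rightarrow> real) \<Rightarrow> ('t \<Rightarrow> 'x \<Rightarrow> real) set" where
  "bochner_Linf M X N = {F. strongly_measurable M X N F \<and> (\<lambda>t. N (F t)) \<in> Linf M}"


section \<open>Weak derivatives and distributional inequalities\<close>

definition has_weak_deriv ::
  "'a::euclidean_space set \<Rightarrow> 'a \<Rightarrow> ('a \<Rightarrow> real) \<Rightarrow> ('a \<Rightarrow> real) \<Rightarrow> bool" where
  "has_weak_deriv S v f h \<longleftrightarrow>
     f \<in> Lp_loc 1 (lebesgue_on S) \<and> h \<in> Lp_loc 1 (lebesgue_on S) \<and>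
     (\<forall>\<phi>\<in>Cc_infty S.
        (LINT z|lebesgue_on S. f z * frechet_derivative \<phi> (at z) v) =
        - (LINT z|lebesgue_on S. h z * \<phi> z))"

definition weakly_differentiable ::
  "'a::euclidean_space set \<Rightarrow> 'a \<Rightarrow> ('a \<Rightarrow> real) \<Rightarrow> bool" where
  "weakly_differentiable S v f \<longleftrightarrow> (\<exists>h. has_weak_deriv S v f h)"

text \<open>Determined almost everywhere when it exists; a representative is chosen.\<close>
definition weak_deriv :: "'a::euclidean_space set \<Rightarrow> 'a \<Rightarrow> ('a \<Rightarrow> real) \<Rightarrow> 'a \<Rightarrow> real" where
  "weak_deriv S v f = (SOME h. has_weak_deriv S v f h)"

text \<open>The derivative of \<open>f\<close> in direction \<open>v\<close> is at least \<open>h\<close>, as distributions on the open set \<open>S\<close>.\<close>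
definition distr_deriv_ge ::
  "'a::euclidean_space set \<Rightarrow> 'a \<Rightarrow> ('a \<Rightarrow> real) \<Rightarrow> ('a \<Rightarrow> real) \<Rightarrow> bool" where
  "distr_deriv_ge S v f h \<longleftrightarrow>
     f \<in> Lp_loc 1 (lebesgue_on S) \<and> h \<in> Lp_loc 1 (lebesgue_on S) \<and>
     (\<forall>\<phi>\<in>Cc_infty S. (\<forall>z\<in>S. 0 \<le> \<phi> z) \<longrightarrow>
        - (LINT z|lebesgue_on S. f z * frechet_derivative \<phi> (at z) v) \<ge>
        (LINT z|lebesgue_on S. h z * \<phi> z))"


section \<open>The weighted setting\<close>

abbreviation \<Omega> :: "real set" where "\<Omega> \<equiv> {0<..}"

abbreviation QT :: "real \<Rightarrow> (real \<times> real) set" where "QT T \<equiv> {0<..<T} \<times> \<Omega>"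

text \<open>Points of space-time are pairs \<open>(t, x)\<close>.\<close>
abbreviation dir_t :: "real \<times> real" where "dir_t \<equiv> (1, 0)"
abbreviation dir_x :: "real \<times> real" where "dir_x \<equiv> (0, 1)"

definition rho :: "real \<Rightarrow> real \<Rightarrow> real" where
  "rho lam x = sqrt x * (x + lam) * sqrt (x + 2 * lam)"

definition nu :: "real \<Rightarrow> real measure" where
  "nu lam = density (lebesgue_on \<Omega>) (\<lambda>x. ennreal (1 / rho lam x))"

text \<open>The measure \<open>dt \<times> d\<nu>\<close> on \<open>QT T\<close>, completed.\<close>
definition dt_nu :: "real \<Rightarrow> real \<Rightarrow> (real \<times> real) measure" where
  "dt_nu lam T = density (lebesgue_on (QT T)) (\<lambda>(t, x). ennreal (1 / rho lam x))"

definition hypothesis_H ::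
  "real \<Rightarrow> real \<Rightarrow> (real \<Rightarrow> real) \<Rightarrow> (real \<Rightarrow> real) \<Rightarrow> bool" where
  "hypothesis_H lam \<delta> g u0 \<longleftrightarrow>
     0 < \<delta> \<and> \<delta> < 1 \<and>
     (\<lambda>x. rho lam x * g x) \<in> Linf (lebesgue_on \<Omega>) \<and>
     (AE x in lebesgue_on \<Omega>. 0 \<le> u0 x) \<and>
     (lam = 0 \<longrightarrow> u0 \<in> Lp \<delta> (nu lam) \<inter> Lp 3 (nu lam)) \<and>
     (lam > 0 \<longrightarrow> u0 \<in> Lp 1 (nu lam) \<inter> Lp 3 (nu lam))"


section \<open>Weak solutions\<close>

definition V0_norm :: "real \<Rightarrow> real \<Rightarrow> (real \<Rightarrow> real) \<Rightarrow> real" where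
  "V0_norm lam p f = Lp_norm p (nu lam) f + Lp_norm 2 (lebesgue_on \<Omega>) (weak_deriv \<Omega> 1 f)"

text \<open>
  The closure is realised inside the functions in \<open>L\<^sup>p(\<nu>)\<close> with weak derivative in \<open>L\<^sup>2\<close>; this loses
  nothing, since convergence in \<open>L\<^sup>p(\<nu>)\<close> with \<open>p \<ge> 1\<close> implies convergence in \<open>L\<^sup>1\<^sub>l\<^sub>o\<^sub>c(\<Omega>)\<close>.
\<close>
definition V0 :: "real \<Rightarrow> real \<Rightarrow> (real \<Rightarrow> real) set" where
  "V0 lam p = {f \<in> Lp p (nu lam).
     weakly_differentiable \<Omega> 1 f \<and> weak_deriv \<Omega> 1 f \<in> Lp 2 (lebesgue_on \<Omega>) \<and>
     (\<exists>\<phi>. (\<forall>k. \<phi> k \<in> Cc_infty \<Omega>) \<and>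
          (\<lambda>k::nat. V0_norm lam p (\<lambda>x. f x - \<phi> k x)) \<longlonglongrightarrow> 0)}"

text \<open>
  The gradient is only locally square integrable in the open set \<open>QT T\<close> while test functions may
  not vanish at \<open>t = 0\<close>, so the convergence of the integral of the squared gradient against \<open>\<phi>\<close> is
  part of the weak formulation. The other integrals converge by the remaining requirements and
  the assumptions on the data.
\<close>
definition weak_solution ::
  "real \<Rightarrow> real \<Rightarrow> (real \<Rightarrow> real) \<Rightarrow> (real \<Rightarrow> real) \<Rightarrow> (real \<times> real \<Rightarrow> real) \<Rightarrow> bool" where
  "weak_solution lam T g u0 u \<longleftrightarrow>
     u \<in> borel_measurable (lebesgue_on (QT T)) \<and>
     (AE z in lebesgue_on (QT T). 0 \<le> u z) \<and>
     (\<lambda>t x. (u (t, x))\<^sup>2) \<in>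
       bochner_Lp (3/2) (lebesgue_on {0<..<T}) (V0 lam (3/2)) (V0_norm lam (3/2)) \<and>
     weakly_differentiable (QT T) dir_x (\<lambda>z. (u z)\<^sup>2) \<and>
     weak_deriv (QT T) dir_x (\<lambda>z. (u z)\<^sup>2) \<in> Lp 2 (lebesgue_on (QT T)) \<and>
     weakly_differentiable (QT T) dir_x u \<and>
     weak_deriv (QT T) dir_x u \<in> Lp_loc 2 (lebesgue_on (QT T)) \<and>
     (\<forall>\<phi>\<in>Cc_infty ({0..<T} \<times> \<Omega>).
        integrable (lebesgue_on (QT T)) (\<lambda>z. (weak_deriv (QT T) dir_x u z)\<^sup>2 * \<phi> z) \<and>
        - (LINT z|dt_nu lam T. u z * frechet_derivative \<phi> (at z) dir_t)
        + (LINT z|lebesgue_on (QT T).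
             weak_deriv (QT T) dir_x (\<lambda>z. (u z)\<^sup>2 / 2) z * frechet_derivative \<phi> (at z) dir_x)
        + (LINT z|lebesgue_on (QT T). \<bar>weak_deriv (QT T) dir_x u z\<bar>\<^sup>2 * \<phi> z)
        = (LINT x|nu lam. u0 x * \<phi> (0, x))
        + (LINT z|lebesgue_on (QT T). \<phi> z * u z * g (snd z)))"


section \<open>Regularized solutions\<close>

definition holder_on :: "real \<Rightarrow> real set \<Rightarrow> (real \<Rightarrow> real) \<Rightarrow> bool" where
  "holder_on \<beta> S f \<longleftrightarrow> (\<exists>C. \<forall>x\<in>S. \<forall>y\<in>S. \<bar>f x - f y\<bar> \<le> C * \<bar>x - y\<bar> powr \<beta>)"

definition parabolic_holder_on ::
  "real \<Rightarrow> (real \<times> real) set \<Rightarrow> (real \<times> real \<Rightarrow> real) \<Rightarrow> bool" where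
  "parabolic_holder_on \<beta> S w \<longleftrightarrow>
     (\<exists>C. \<forall>(t, x)\<in>S. \<forall>(s, y)\<in>S.
        \<bar>w (t, x) - w (s, y)\<bar> \<le> C * (\<bar>t - s\<bar> powr (\<beta> / 2) + \<bar>x - y\<bar> powr \<beta>))"

definition Cc_2_holder :: "real \<Rightarrow> real set \<Rightarrow> (real \<Rightarrow> real) set" where
  "Cc_2_holder \<beta> S = {f.
     (\<exists>f' f''. (\<forall>x\<in>S. (f has_real_derivative f' x) (at x) \<and>
                      (f' has_real_derivative f'' x) (at x)) \<and> holder_on \<beta> S f'') \<and>
     (\<exists>K. compact K \<and> K \<subseteq> S \<and> (\<forall>x\<in>S - K. f x = 0))}"

text \<open>The space \<open>C\<close> with exponents \<open>1 + \<beta>/2\<close> in \<open>t\<close> and \<open>2 + \<beta>\<close> in \<open>x\<close> on \<open>[0,T] \<times> [a,b]\<close>;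
  derivatives at the boundary are one-sided.\<close>
definition parabolic_C12_holder ::
  "real \<Rightarrow> real \<Rightarrow> real \<Rightarrow> real \<Rightarrow> (real \<times> real \<Rightarrow> real) set" where
  "parabolic_C12_holder \<beta> T a b = {u. \<exists>ut ux uxx.
     (\<forall>t\<in>{0..T}. \<forall>x\<in>{a..b}.
        ((\<lambda>s. u (s, x)) has_real_derivative ut (t, x)) (at t within {0..T}) \<and>
        ((\<lambda>y. u (t, y)) has_real_derivative ux (t, x)) (at x within {a..b}) \<and>
        ((\<lambda>y. ux (t, y)) has_real_derivative uxx (t, x)) (at x within {a..b})) \<and>
     continuous_on ({0..T} \<times> {a..b}) u \<and> continuous_on ({0..T} \<times> {a..b}) ux \<and>
     parabolic_holder_on \<beta> ({0..T} \<times> {a..b}) ut \<and>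
     parabolic_holder_on \<beta> ({0..T} \<times> {a..b}) uxx}"

text \<open>
  Only the indices \<open>n \<ge> 1\<close> matter. The initial data \<open>v0 n\<close> and the functions \<open>gn n\<close> are functions
  on \<open>\<Omega>\<close>, extended by zero from \<open>\<Omega>\<^sub>n = (a n, b n)\<close>; \<open>\<beta> n\<close> is the Hoelder exponent for the index \<open>n\<close>.
\<close>
definition admissible_data ::
  "real \<Rightarrow> real \<Rightarrow> (real \<Rightarrow> real) \<Rightarrow> (real \<Rightarrow> real) \<Rightarrow> (nat \<Rightarrow> real) \<Rightarrow> (nat \<Rightarrow> real) \<Rightarrow>
   (nat \<Rightarrow> real) \<Rightarrow> (nat \<Rightarrow> real) \<Rightarrow> (nat \<Rightarrow> real \<Rightarrow> real) \<Rightarrow> (nat \<Rightarrow> real \<Rightarrow> real) \<Rightarrow> bool" where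
  "admissible_data lam \<delta> g u0 a b r \<beta> v0 gn \<longleftrightarrow>
     (\<forall>n\<ge>1. 0 < a n \<and> a n < b n \<and> a (Suc n) < a n \<and> b n < b (Suc n)) \<and>
     a \<longlonglongrightarrow> 0 \<and> filterlim b at_top sequentially \<and>
     (\<lambda>n. measure (nu lam) {a n<..<b n} / real n) \<longlonglongrightarrow> 0 \<and>
     (\<forall>n\<ge>1. 0 < r n) \<and> r \<longlonglongrightarrow> 0 \<and>
     filterlim (\<lambda>n. r n * real n powr \<delta>) at_top sequentially \<and>
     (\<forall>n\<ge>1. (\<lambda>x. rho lam x * gn n x) \<in> Cc_infty {a n<..<b n}) \<and>
     (\<forall>n\<ge>1. 0 < \<beta> n \<and> \<beta> n < 1 \<and> v0 n \<in> Cc_2_holder (\<beta> n) {a n<..<b n} \<and>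
             (\<forall>x\<in>\<Omega>. 0 \<le> v0 n x)) \<and>
     (\<forall>p\<in>{\<delta>..3}. Lp_tendsto p (nu lam) v0 u0) \<and>
     (\<forall>p\<ge>1. Lp_loc_tendsto p (lebesgue_on \<Omega>) (\<lambda>n x. rho lam x * gn n x)
                (\<lambda>x. rho lam x * g x)) \<and>
     (AE x in lebesgue_on \<Omega>. (\<lambda>n. rho lam x * gn n x) \<longlonglongrightarrow> rho lam x * g x) \<and>
     (\<forall>n\<ge>1. essinf (lebesgue_on {a n<..<b n}) (\<lambda>x. ereal (rho lam x * gn n x)) \<ge>
             min (essinf (lebesgue_on \<Omega>) (\<lambda>x. ereal (rho lam x * g x))) 0) \<and>
     (\<forall>n\<ge>1. Linf_norm (lebesgue_on \<Omega>) (\<lambda>x. rho lam x * gn n x) \<le>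
             Linf_norm (lebesgue_on \<Omega>) (\<lambda>x. rho lam x * g x)) \<and>
     (\<forall>n\<ge>1. \<forall>x\<in>\<Omega> - {a n + r n..b n - r n}. v0 n x = 0 \<and> rho lam x * gn n x = 0)"

text \<open>
  Uniqueness is not part of the definition: for given data, any two functions with these
  properties agree on \<open>[0,T] \<times> [a,b]\<close> and on \<open>QT T\<close> by the comparison principle.
\<close>
definition regularized_solution ::
  "real \<Rightarrow> real \<Rightarrow> nat \<Rightarrow> real \<Rightarrow> real \<Rightarrow> real \<Rightarrow> (real \<Rightarrow> real) \<Rightarrow> (real \<Rightarrow> real) \<Rightarrow>
   (real \<times> real \<Rightarrow> real) \<Rightarrow> bool" where
  "regularized_solution lam T n a b \<beta> v0 g u \<longleftrightarrow>
     u \<in> parabolic_C12_holder \<beta> T a b \<and>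
     (\<forall>t\<in>{0<..<T}. \<forall>x\<in>{a<..<b}.
        deriv (\<lambda>s. u (s, x)) t =
          rho lam x * (u (t, x) + 1 / real n) * (deriv ^^ 2) (\<lambda>y. u (t, y)) x
          + rho lam x * g x * (u (t, x) + 1 / real n)) \<and>
     (\<forall>x\<in>{a<..<b}. u (0, x) = v0 x) \<and>
     (\<forall>t\<in>{0..T}. u (t, a) = 0 \<and> u (t, b) = 0) \<and>
     (\<forall>(t, x)\<in>QT T. x \<notin> {a<..<b} \<longrightarrow> u (t, x) = 0)"


section \<open>Constructed weak solutions\<close>

text \<open>The subsequence is \<open>un (\<sigma> 0), un (\<sigma> 1), \<dots>\<close>.\<close>
definition constructed_weak_solution ::
  "real \<Rightarrow> real \<Rightarrow> real \<Rightarrow> (real \<Rightarrow> real) \<Rightarrow> (real \<Rightarrow> real) \<Rightarrow> (real \<times> real \<Rightarrow> real) \<Rightarrow> bool" where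
  "constructed_weak_solution lam \<delta> T g u0 u \<longleftrightarrow>
     weak_solution lam T g u0 u \<and>
     weak_deriv (QT T) dir_x u \<in> Lp 2 (lebesgue_on (QT T)) \<and>
     (\<forall>p. p \<in> {1..3} \<or> (lam = 0 \<and> p = \<delta>) \<longrightarrow>
        (\<lambda>t x. u (t, x)) \<in> bochner_Linf (lebesgue_on {0<..<T}) (Lp p (nu lam)) (Lp_norm p (nu lam))) \<and>
     (\<exists>a b r \<beta> v0 gn un \<sigma>.
        admissible_data lam \<delta> g u0 a b r \<beta> v0 gn \<and>
        (\<forall>n\<ge>1. regularized_solution lam T n (a n) (b n) (\<beta> n) (v0 n) (gn n) (un n)) \<and>
        strict_mono \<sigma> \<and> 1 \<le> \<sigma> 0 \<and>
        (\<forall>q\<in>{\<delta><..<3}. Lp_loc_tendsto q (dt_nu lam T) (\<lambda>k. un (\<sigma> k)) u) \<and>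
        (AE z in lebesgue_on (QT T). (\<lambda>k. un (\<sigma> k) z) \<longlonglongrightarrow> u z) \<and>
        weak_L2_tendsto (lebesgue_on (QT T))
          (\<lambda>k. weak_deriv (QT T) dir_x (un (\<sigma> k))) (weak_deriv (QT T) dir_x u) \<and>
        weak_L2_tendsto (lebesgue_on (QT T))
          (\<lambda>k. weak_deriv (QT T) dir_x (\<lambda>z. (un (\<sigma> k) z)\<^sup>2))
          (weak_deriv (QT T) dir_x (\<lambda>z. (u z)\<^sup>2)) \<and>
        Lp_loc_tendsto 2 (lebesgue_on (QT T))
          (\<lambda>k. weak_deriv (QT T) dir_x (un (\<sigma> k))) (weak_deriv (QT T) dir_x u) \<and>
        (AE z in lebesgue_on (QT T).
           (\<lambda>k. weak_deriv (QT T) dir_x (un (\<sigma> k)) z) \<longlonglongrightarrow> weak_deriv (QT T) dir_x u z))"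

definition theta :: "real \<Rightarrow> (real \<Rightarrow> real) \<Rightarrow> real" where
  "theta lam g = max (real_of_ereal (esssup (lebesgue_on \<Omega>) (\<lambda>x. ereal (- (rho lam x * g x))))) 0"

definition K_theta :: "real \<Rightarrow> real \<Rightarrow> real" where
  "K_theta \<theta> t = (if \<theta> = 0 then t else 1 / \<theta> * ((exp (\<theta> * t) - 1) / exp (\<theta> * t)))"

end

theory Submission
  imports Defs
begin

text \<open>
  The positive regularized function \<open>w = u\<^sub>n + 1/n\<close> solves \<open>w\<^sub>t = \<rho> w w\<^sub>x\<^sub>x + \<rho> g\<^sub>n w\<close>, but is only known to
  be \<open>C\<close> with exponents \<open>1 + \<beta>/2\<close>, \<open>2 + \<beta>\<close>, so the usual maximum principle for \<open>w\<^sub>t / w\<close> is not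
  available without interior regularity theory. Instead, compare \<open>w\<close> with the strict supersolution
  \<open>(1 + \<epsilon> exp (\<kappa> t)) w(t + \<epsilon> (exp (\<kappa> t) - 1)/\<kappa>, x)\<close>, where \<open>\<kappa> > \<theta>\<close>, and differentiate at \<open>\<epsilon> = 0\<close>:
  this gives \<open>exp (\<kappa> t) w + w\<^sub>t (exp (\<kappa> t) - 1)/\<kappa> \<ge> 0\<close>, and \<open>\<kappa> \<rightarrow> \<theta>\<close> yields \<open>w\<^sub>t \<ge> - w / K\<^sub>\<theta>(t)\<close>.
  Tested against \<open>\<phi> \<ge> 0\<close> and integrated by parts in \<open>t\<close>, this inequality passes to the limit by the
  local \<open>L\<^sup>1\<close> convergence of \<open>u\<^sub>n\<close>.
\<close>

section \<open>Touching points and the time-scaling comparison\<close>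

text \<open>Compactness yields a point with \<open>d \<le> 0\<close> at the smallest possible time.
  Before that time \<open>d\<close> is positive, so continuity makes the point a zero, away from the
  initial line and the lateral sides, to which \<open>touch\<close> applies.\<close>

lemma strict_comparison_from_touching:
  fixes d :: "real \<times> real \<Rightarrow> real"
  assumes cont: "continuous_on ({0..T} \<times> {a..b}) d"
    and init: "\<And>x. x \<in> {a..b} \<Longrightarrow> 0 < d (0, x)"
    and bdry: "\<And>t. t \<in> {0..T} \<Longrightarrow> 0 < d (t, a) \<and> 0 < d (t, b)"
    and touch: "\<And>t x. \<lbrakk>0 < t; t \<le> T; a < x; x < b; d (t, x) = 0;
      \<forall>s\<in>{0..t}. 0 \<le> d (s, x); \<forall>y\<in>{a..b}. 0 \<le> d (t, y)\<rbrakk> \<Longrightarrow> False"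
    and "t \<in> {0..T}" "x \<in> {a..b}"
  shows "0 < d (t, x)"
proof (rule ccontr)
  assume neg: "\<not> 0 < d (t, x)"
  define R where "R = {0..T} \<times> {a..b}"
  define Z where "Z = {z \<in> R. d z \<le> 0}"
  have "compact R" by (auto simp: R_def intro!: compact_Times)
  moreover have "closed Z"
    unfolding Z_def using cont by (auto simp: R_def intro!: continuous_closed_preimage_constant closed_Times
      continuous_on_closed_Collect_le)
  ultimately have "compact Z"
    by (metis (no_types, lifting) Z_def closed_Int_compact inf.absorb1 mem_Collect_eq subsetI)
  moreover have "(t, x) \<in> Z" using neg assms(5,6) by (auto simp: Z_def R_def)
  ultimately obtain z0 where z0: "z0 \<in> Z" "\<And>z. z \<in> Z \<Longrightarrow> fst z0 \<le> fst z"
    using continuous_attains_inf[of Z fst] continuous_on_fst[OF continuous_on_id] by blast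
  obtain t0 x0 where z0_eq: "z0 = (t0, x0)" by (cases z0)
  have in_R: "t0 \<in> {0..T}" "x0 \<in> {a..b}" and le0: "d (t0, x0) \<le> 0"
    using z0(1) by (auto simp: z0_eq Z_def R_def)
  have before: "0 < d (s, y)" if "s \<in> {0..<t0}" "y \<in> {a..b}" for s y
  proof (rule ccontr)
    assume "\<not> 0 < d (s, y)"
    then have "(s, y) \<in> Z" using that in_R by (auto simp: Z_def R_def)
    from z0(2)[OF this] that show False by (simp add: z0_eq)
  qed
  have "t0 \<noteq> 0" using init[OF in_R(2)] le0 by auto
  then have t0: "0 < t0" using in_R by auto
  \<comment> \<open>The values at time \<open>t0\<close> are limits of the positive values at
    earlier times; this is where \<open>t0 > 0\<close> is needed.\<close>
  have at_t0: "0 \<le> d (t0, y)" if y: "y \<in> {a..b}" for y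
  proof (rule tendsto_lowerbound)
    have "continuous_on {0..T} (\<lambda>s. d (s, y))"
      by (rule continuous_on_compose2[OF cont]) (use y in \<open>auto intro!: continuous_intros\<close>)
    then have "((\<lambda>s. d (s, y)) \<longlongrightarrow> d (t0, y)) (at t0 within {0..T})"
      using in_R by (auto simp: continuous_on_def)
    moreover have "at t0 within {0..<t0} \<le> at t0 within {0..T}"
      by (rule at_le) (use in_R in auto)
    ultimately show "((\<lambda>s. d (s, y)) \<longlongrightarrow> d (t0, y)) (at t0 within {0..<t0})"
      using tendsto_mono by blast
    show "\<forall>\<^sub>F s in at t0 within {0..<t0}. 0 \<le> d (s, y)"
      using before[OF _ y] by (auto simp: eventually_at_filter less_imp_le)
    show "at t0 within {0..<t0} \<noteq> bot"
      using t0 by (simp add: trivial_limit_within islimpt_Ico)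
  qed
  have "0 \<le> d (s, x0)" if "s \<in> {0..t0}" for s
    using before[of s x0] at_t0[of x0] in_R that by (cases "s = t0") (auto simp: less_imp_le)
  moreover have "x0 \<noteq> a" "x0 \<noteq> b" using bdry[OF in_R(1)] le0 by auto
  ultimately show False
    using touch[of t0 x0] t0 in_R at_t0 le0 by (auto simp: order.strict_iff_order antisym)
qed

text \<open>The second derivative is only known to exist at \<open>x\<close>, so no Taylor expansion
  is used. If \<open>D\<close> were negative, \<open>f'\<close> would be negative just to the right
  of its zero \<open>x\<close>, and the mean value theorem would make \<open>f\<close> drop below
  its minimum.\<close>

lemma second_derivative_nonneg_at_min:
  fixes f :: "real \<Rightarrow> real"
  assumes x: "a < x" "x < b"
    and min: "\<And>y. a < y \<Longrightarrow> y < b \<Longrightarrow> f x \<le> f y"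
    and f': "\<And>y. a < y \<Longrightarrow> y < b \<Longrightarrow> (f has_real_derivative f' y) (at y)"
    and f'': "(f' has_real_derivative D) (at x)"
  shows "0 \<le> D"
proof (rule ccontr)
  assume "\<not> 0 \<le> D"
  then obtain \<epsilon> where \<epsilon>: "\<epsilon> > 0" "\<And>h. 0 < h \<Longrightarrow> h < \<epsilon> \<Longrightarrow> f' (x + h) < f' x"
    using DERIV_neg_dec_right[OF f''] by auto
  \<comment> \<open>Halving keeps \<open>y\<close> strictly inside the interval and within the range
    where \<open>f'\<close> lies below \<open>f' x\<close>.\<close>
  define y where "y = x + min \<epsilon> (b - x) / 2"
  have y: "x < y" "y < b" "y < x + \<epsilon>" using x \<epsilon> by (auto simp: y_def min_def field_simps)
  have "f' x = 0"
  proof (rule DERIV_local_min[OF f'[OF x]])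
    show "0 < min (x - a) (b - x)" using x by simp
    show "\<forall>y. \<bar>x - y\<bar> < min (x - a) (b - x) \<longrightarrow> f x \<le> f y" using min by (auto simp: abs_less_iff)
  qed
  obtain z where z: "x < z" "z < y" "f y - f x = (y - x) * f' z"
  proof -
    have "(f has_real_derivative f' z) (at z)" if "x \<le> z" "z \<le> y" for z
      by (rule f') (use that x y in auto)
    then show ?thesis using MVT2[of x y f f'] y that by auto
  qed
  then have "f' z < 0" using \<epsilon>(2)[of "z - x"] y \<open>f' x = 0\<close> by auto
  then have "f y < f x" using z y mult_pos_neg[of "y - x" "f' z"] by linarith
  then show False using min[of y] x y by auto
qed

text \<open>A positive derivative would force smaller values just before \<open>t\<close>. Only the
  past of \<open>t\<close> enters, since nothing is known about times after a first
  touching.\<close>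

lemma derivative_nonpos_at_first_zero:
  fixes f :: "real \<Rightarrow> real"
  assumes "(f has_real_derivative D) (at t)" "a < t" "\<And>s. a < s \<Longrightarrow> s < t \<Longrightarrow> f t \<le> f s"
  shows "D \<le> 0"
proof (rule ccontr)
  assume "\<not> D \<le> 0"
  then obtain \<epsilon> where \<epsilon>: "\<epsilon> > 0" "\<And>h. 0 < h \<Longrightarrow> h < \<epsilon> \<Longrightarrow> f (t - h) < f t"
    using DERIV_pos_inc_left[OF assms(1)] by auto
  define h where "h = min \<epsilon> (t - a) / 2"
  have "0 < h" "h < \<epsilon>" "a < t - h" using assms(2) \<epsilon>(1) by (auto simp: h_def min_def field_simps)
  then show False using \<epsilon>(2)[of h] assms(3)[of "t - h"] by auto
qed

section \<open>The time factor \<open>K_theta\<close> and its dependence on the rate\<close>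

lemma K_theta_pos: "0 \<le> \<theta> \<Longrightarrow> 0 < t \<Longrightarrow> 0 < K_theta \<theta> t"
  by (auto simp: K_theta_def)

lemma continuous_on_K_theta: "continuous_on S (K_theta \<theta>)"
  unfolding K_theta_def by (cases "\<theta> = 0") (auto intro!: continuous_intros)

lemma K_theta_tendsto_right:
  assumes "0 \<le> \<theta>"
  shows "((\<lambda>\<kappa>. K_theta \<kappa> t) \<longlongrightarrow> K_theta \<theta> t) (at_right \<theta>)"
proof -
  \<comment> \<open>For \<kappa> > \<theta> \<ge> 0 only the branch of \<open>K_theta\<close> with
    nonzero rate occurs, so the limit is computed for that formula alone.\<close>
  have "((\<lambda>\<kappa>. 1 / \<kappa> * ((exp (\<kappa> * t) - 1) / exp (\<kappa> * t))) \<longlongrightarrow> K_theta \<theta> t) (at_right \<theta>)"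
  proof (cases "\<theta> = 0")
    case True
    \<comment> \<open>This is the difference quotient of \<open>exp (\<kappa> * t)\<close> in the
      variable \<kappa> at 0.\<close>
    have "((\<lambda>\<kappa>. (exp (\<kappa> * t) - 1) / \<kappa>) \<longlongrightarrow> t) (at_right 0)"
    proof -
      have "((\<lambda>\<kappa>. exp (\<kappa> * t)) has_real_derivative t) (at 0 within {0<..})"
        by (auto intro!: derivative_eq_intros)
      then show ?thesis by (simp add: has_field_derivative_iff)
    qed
    then have "((\<lambda>\<kappa>. (exp (\<kappa> * t) - 1) / \<kappa> / exp (\<kappa> * t)) \<longlongrightarrow> t / exp (0 * t)) (at_right 0)"
      by (intro tendsto_intros) auto
    then show ?thesis by (simp add: True K_theta_def)
  next
    case False
    then have "((\<lambda>\<kappa>. 1 / \<kappa> * ((exp (\<kappa> * t) - 1) / exp (\<kappa> * t))) \<longlongrightarrow>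
        1 / \<theta> * ((exp (\<theta> * t) - 1) / exp (\<theta> * t))) (at_right \<theta>)"
      by (intro tendsto_intros) auto
    then show ?thesis by (simp add: False K_theta_def)
  qed
  then show ?thesis
    by (rule Lim_transform_eventually)
      (use assms in \<open>auto simp: eventually_at_filter K_theta_def\<close>)
qed

text \<open>Abstract form of the equation for \<open>w = u\<^sub>n + 1/n\<close>, with
  \<open>e = 1/n\<close>, \<open>R\<close> the weight and \<open>h\<close> the weighted source.
  Derivatives are required only pointwise in the interior, without continuity. The two-sided bound
  \<open>M\<close> serves positivity; the sharper lower bound by \<theta> determines the final
  constant.\<close>

locale parabolic_problem =
  fixes T a b e M \<theta> :: real
    and w wt wx wxx :: "real \<times> real \<Rightarrow> real" and R h :: "real \<Rightarrow> real"
  assumes ab: "a < b" and e_pos: "0 < e" and \<theta>_nonneg: "0 \<le> \<theta>"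
    and w_cont: "continuous_on ({0..T} \<times> {a..b}) w"
    and w_t: "\<And>t x. \<lbrakk>0 < t; t < T; a < x; x < b\<rbrakk> \<Longrightarrow> ((\<lambda>s. w (s, x)) has_real_derivative wt (t, x)) (at t)"
    and w_x: "\<And>t x. \<lbrakk>0 < t; t < T; a < x; x < b\<rbrakk> \<Longrightarrow> ((\<lambda>y. w (t, y)) has_real_derivative wx (t, x)) (at x)"
    and w_xx: "\<And>t x. \<lbrakk>0 < t; t < T; a < x; x < b\<rbrakk> \<Longrightarrow> ((\<lambda>y. wx (t, y)) has_real_derivative wxx (t, x)) (at x)"
    and pde: "\<And>t x. \<lbrakk>0 < t; t < T; a < x; x < b\<rbrakk> \<Longrightarrow> wt (t, x) = R x * w (t, x) * wxx (t, x) + h x * w (t, x)"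
    and R_pos: "\<And>x. \<lbrakk>a < x; x < b\<rbrakk> \<Longrightarrow> 0 < R x"
    and h_bound: "\<And>x. \<lbrakk>a < x; x < b\<rbrakk> \<Longrightarrow> \<bar>h x\<bar> \<le> M"
    and h_lower: "\<And>x. \<lbrakk>a < x; x < b\<rbrakk> \<Longrightarrow> - \<theta> \<le> h x"
    and init: "\<And>x. x \<in> {a..b} \<Longrightarrow> e \<le> w (0, x)"
    and bdry: "\<And>t. t \<in> {0..T} \<Longrightarrow> w (t, a) = e \<and> w (t, b) = e"
begin

text \<open>The function \<open>m\<close> is a strict subsolution independent of \<open>x\<close>.
  At a first contact the equation gives \<open>wt \<ge> - M * m\<close>, while contact from above
  gives \<open>wt \<le> - (M + 1) * m\<close>.\<close>

lemma w_pos: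
  assumes t: "0 \<le> t" "t < T" and x: "x \<in> {a..b}"
  shows "0 < w (t, x)"
proof -
  \<comment> \<open>The factor \<open>e / 2\<close> keeps \<open>m\<close> below the initial and
    boundary values of \<open>w\<close>; the extra 1 in the rate makes the contradiction
    strict.\<close>
  define m where "m = (\<lambda>t. e / 2 * exp (- (M + 1) * t))"
  define d where "d = (\<lambda>z. w z - m (fst z))"
  have M: "0 \<le> M" using h_bound[of "(a + b) / 2"] ab by auto
  have m_pos: "0 < m s" for s using e_pos by (simp add: m_def)
  have m_less: "m s < e" if "0 \<le> s" for s
  proof -
    have "exp (- (M + 1) * s) \<le> 1" using M that by (simp add: mult_nonpos_nonneg)
    then have "m s \<le> e / 2" using e_pos by (simp add: m_def mult_le_cancel_left1)
    then show ?thesis using e_pos by simp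
  qed
  have "0 < d (t, x)"
  \<comment> \<open>The comparison runs on \<open>[0, t]\<close> with \<open>t < T\<close>, because
    a contact may occur at the final time and the equation is available only before
    \<open>T\<close>.\<close>
  proof (rule strict_comparison_from_touching[where T = t and a = a and b = b])
    have "continuous_on ({0..t} \<times> {a..b}) w"
      by (rule continuous_on_subset[OF w_cont]) (use t in auto)
    then show "continuous_on ({0..t} \<times> {a..b}) d"
      unfolding d_def m_def by (intro continuous_intros)
    show "0 < d (0, y)" if "y \<in> {a..b}" for y
      using init[OF that] m_less[of 0] by (simp add: d_def)
    show "0 < d (s, a) \<and> 0 < d (s, b)" if "s \<in> {0..t}" for s
      using bdry[of s] m_less[of s] that t by (auto simp: d_def)
  next
    fix s y
    assume s: "0 < s" "s \<le> t" and y: "a < y" "y < b" and zero: "d (s, y) = 0"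
      and past: "\<forall>r\<in>{0..s}. 0 \<le> d (r, y)" and now: "\<forall>z\<in>{a..b}. 0 \<le> d (s, z)"
    have sT: "s < T" using s t by simp
    have wm: "w (s, y) = m s" using zero by (simp add: d_def)
    have "0 \<le> wxx (s, y)"
    proof (rule second_derivative_nonneg_at_min[OF y])
      show "w (s, y) \<le> w (s, z)" if "a < z" "z < b" for z
        using now that wm by (auto simp: d_def)
    qed (use w_x w_xx s sT y in auto)
    moreover have "wt (s, y) + (M + 1) * m s \<le> 0"
    proof (rule derivative_nonpos_at_first_zero)
      show "((\<lambda>r. w (r, y) - m r) has_real_derivative wt (s, y) + (M + 1) * m s) (at s)"
        unfolding m_def
        by (rule derivative_eq_intros w_t s sT y refl)+ (auto simp: algebra_simps)
      show "w (s, y) - m s \<le> w (r, y) - m r" if "0 < r" "r < s" for r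
        using past that wm by (auto simp: d_def)
    qed (use s in auto)
    moreover have "- (M * m s) \<le> h y * m s"
      using h_bound[OF y] m_pos[of s] by (metis abs_le_D2 less_imp_le minus_le_iff minus_mult_left mult_right_mono)
    moreover have "0 \<le> R y * m s * wxx (s, y)"
      using R_pos[OF y] m_pos[of s] \<open>0 \<le> wxx (s, y)\<close> by simp
    ultimately show False
      using pde[OF s(1) sT y] m_pos[of s] by (simp add: wm algebra_simps)
  qed (use t x in auto)
  then show ?thesis using m_pos[of t] by (simp add: d_def)
qed

text \<open>
  The time-rescaled function \<open>c w(s, x)\<close> with \<open>s' = c = 1 + \<epsilon> exp (\<kappa> t)\<close> solves the equation with the
  zeroth-order coefficient \<open>h\<close> replaced by \<open>c'/c + c h\<close>, which exceeds \<open>h\<close> as soon as \<open>\<theta> c < \<kappa>\<close>.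
\<close>
lemma time_rescaling_comparison:
  fixes \<kappa> \<epsilon> :: real
  defines "c \<equiv> \<lambda>t. 1 + \<epsilon> * exp (\<kappa> * t)"
    and "s \<equiv> \<lambda>t. t + \<epsilon> * ((exp (\<kappa> * t) - 1) / \<kappa>)"
  assumes pos: "0 < \<kappa>" "0 < \<epsilon>" and t1: "0 < t1" "s t1 < T" and small: "\<theta> * c t1 < \<kappa>"
    and x: "x \<in> {a..b}"
  shows "w (t1, x) < c t1 * w (s t1, x)"
proof -
  define d where "d = (\<lambda>z. c (fst z) * w (s (fst z), snd z) - w z)"
  have c_gt1: "1 < c t" for t using pos by (simp add: c_def)
  have s_mono: "s t \<le> s t'" if "t \<le> t'" for t t'
    using pos that by (auto simp: s_def divide_right_mono intro!: add_mono mult_left_mono)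
  have s_ge: "t \<le> s t" if "0 \<le> t" for t
    using pos that by (auto simp: s_def)
  have s_lt_T: "s t < T" if "t \<le> t1" for t using s_mono[OF that] t1 by simp
  \<comment> \<open>Wherever the two values of \<open>w\<close> coincide, positivity of
    \<open>w\<close> and \<open>c t > 1\<close> suffice. This covers the initial line, as
    \<open>s 0 = 0\<close>, and the sides, where \<open>w\<close> is constantly
    \<open>e\<close>.\<close>
  have w_diff_pos: "0 < c t * w (s t, y) - w (t, y)"
    if "0 \<le> t" "t \<le> t1" "w (s t, y) = w (t, y)" "y \<in> {a..b}" for t y
    using w_pos[of t y] c_gt1[of t] that s_ge[of t] s_lt_T[of t] by (simp add: mult_less_cancel_right1)
  have "0 < d (t1, x)"
  proof (rule strict_comparison_from_touching[where T = t1 and a = a and b = b])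
    have "continuous_on ({0..t1} \<times> {a..b}) (\<lambda>z. w (s (fst z), snd z))"
    proof (rule continuous_on_compose2[OF w_cont])
      show "continuous_on ({0..t1} \<times> {a..b}) (\<lambda>z. (s (fst z), snd z))"
        unfolding s_def using pos by (intro continuous_intros) auto
      show "(\<lambda>z. (s (fst z), snd z)) ` ({0..t1} \<times> {a..b}) \<subseteq> {0..T} \<times> {a..b}"
        using s_ge s_lt_T by (fastforce intro: less_imp_le order_trans)
    qed
    moreover have "continuous_on ({0..t1} \<times> {a..b}) w"
      by (rule continuous_on_subset[OF w_cont]) (use s_ge[of t1] t1 in auto)
    ultimately show "continuous_on ({0..t1} \<times> {a..b}) d"
      unfolding d_def c_def by (intro continuous_intros)
    show "0 < d (0, y)" if "y \<in> {a..b}" for y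
      using w_diff_pos[of 0 y] that t1 by (simp add: d_def s_def)
    show "0 < d (t, a) \<and> 0 < d (t, b)" if "t \<in> {0..t1}" for t
    proof -
      have "t \<in> {0..T}" "s t \<in> {0..T}"
        using that s_ge[of t] s_lt_T[of t] by auto
      then show ?thesis
        using bdry[of t] bdry[of "s t"] w_diff_pos[of t a] w_diff_pos[of t b] that ab by (simp add: d_def)
    qed
  next
    fix t y
    assume t: "0 < t" "t \<le> t1" and y: "a < y" "y < b" and zero: "d (t, y) = 0"
      and past: "\<forall>r\<in>{0..t}. 0 \<le> d (r, y)" and now: "\<forall>z\<in>{a..b}. 0 \<le> d (t, z)"
    have st: "0 < s t" "s t < T" "t < T" using t s_ge[of t] s_lt_T[of t] by auto
    define W where "W = w (t, y)"
    have W_eq: "c t * w (s t, y) = W" using zero by (simp add: d_def W_def)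
    have W_pos: "0 < W" using w_pos[of t y] st t y by (simp add: W_def)
    have c': "(c has_real_derivative \<kappa> * (c t - 1)) (at t)"
      unfolding c_def by (auto intro!: derivative_eq_intros)
    have s': "(s has_real_derivative c t) (at t)"
      unfolding c_def s_def using pos by (auto intro!: derivative_eq_intros)
    have "0 \<le> c t * wxx (s t, y) - wxx (t, y)"
    proof (rule second_derivative_nonneg_at_min[OF y])
      show "c t * w (s t, y) - w (t, y) \<le> c t * w (s t, z) - w (t, z)" if "a < z" "z < b" for z
        using now that zero by (auto simp: d_def)
      show "((\<lambda>z. c t * w (s t, z) - w (t, z)) has_real_derivative c t * wx (s t, z) - wx (t, z)) (at z)"
        if "a < z" "z < b" for z
        by (rule DERIV_diff DERIV_cmult w_x st t that)+
      show "((\<lambda>z. c t * wx (s t, z) - wx (t, z)) has_real_derivative c t * wxx (s t, y) - wxx (t, y)) (at y)"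
        by (rule DERIV_diff DERIV_cmult w_xx st t y)+
    qed
    \<comment> \<open>Both diffusion terms carry the same coefficient \<open>R y * W\<close>,
      because one factor \<open>c t\<close> is absorbed by
      \<open>c t * w (s t, y) = W\<close>.\<close>
    then have xx: "R y * W * wxx (t, y) \<le> R y * W * (c t * wxx (s t, y))"
      using R_pos[OF y] W_pos by (intro mult_left_mono) auto
    have ws': "((\<lambda>r. w (s r, y)) has_real_derivative wt (s t, y) * c t) (at t)"
      using DERIV_chain2[OF w_t[OF st(1,2) y] s'] .
    have "\<kappa> * (c t - 1) * w (s t, y) + wt (s t, y) * c t * c t - wt (t, y) \<le> 0"
    proof (rule derivative_nonpos_at_first_zero)
      show "((\<lambda>r. c r * w (s r, y) - w (r, y)) has_real_derivative
          \<kappa> * (c t - 1) * w (s t, y) + wt (s t, y) * c t * c t - wt (t, y)) (at t)"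
        by (rule DERIV_diff DERIV_mult c' ws' w_t t st y)+
      show "c t * w (s t, y) - w (t, y) \<le> c r * w (s r, y) - w (r, y)" if "0 < r" "r < t" for r
        using past that zero by (auto simp: d_def)
    qed (use t in auto)
    moreover have "wt (s t, y) * c t * c t = R y * W * (c t * wxx (s t, y)) + c t * h y * W"
      using pde[OF st(1,2) y] by (simp add: algebra_simps flip: W_eq)
    moreover have "wt (t, y) = R y * W * wxx (t, y) + h y * W"
      using pde[OF t(1) st(3) y] by (simp add: W_def)
    \<comment> \<open>The equation at both times replaces the time derivatives, and
      \<open>xx\<close> discards the diffusion terms. What remains is a multiple of
      \<open>\<kappa> + c t * h y\<close> by a positive factor, which \<open>small\<close> and the
      lower bound on \<open>h\<close> make positive.\<close>
    ultimately have "\<kappa> * (c t - 1) * w (s t, y) + (c t - 1) * h y * W \<le> 0"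
      using xx by (simp add: algebra_simps)
    then have "(c t - 1) * (w (s t, y) * (\<kappa> + c t * h y)) \<le> 0"
      by (simp add: algebra_simps flip: W_eq)
    then have "\<kappa> + c t * h y \<le> 0"
      using c_gt1[of t] w_pos[of "s t" y] st y by (simp add: mult_le_0_iff)
    moreover have "c t * (- \<theta>) \<le> c t * h y"
      using h_lower[OF y] c_gt1[of t] by (intro mult_left_mono) auto
    moreover have "\<theta> * c t \<le> \<theta> * c t1"
      using \<theta>_nonneg t pos by (intro mult_left_mono) (auto simp: c_def)
    ultimately show False using small by (simp add: algebra_simps)
  qed (use t1 x in auto)
  then show ?thesis by (simp add: d_def)
qed

text \<open>At a fixed point the rescaled value \<open>q\<close> lies above \<open>q 0\<close> for
  all small positive \<epsilon>, so its derivative at 0 is nonnegative. That derivative is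
  \<open>E * w + wt * \<eta>\<close>.\<close>

lemma time_derivative_lower_bound_strict:
  assumes \<kappa>: "\<theta> < \<kappa>" and t: "0 < t" "t < T" and x: "a < x" "x < b"
  shows "0 \<le> w (t, x) + wt (t, x) * K_theta \<kappa> t"
proof -
  define E where "E = exp (\<kappa> * t)"
  define \<eta> where "\<eta> = (E - 1) / \<kappa>"
  have \<kappa>_pos: "0 < \<kappa>" using \<kappa> \<theta>_nonneg by simp
  define q where "q = (\<lambda>\<epsilon>. (1 + \<epsilon> * E) * w (t + \<epsilon> * \<eta>, x))"
  have w_t': "((\<lambda>r. w (r, x)) has_real_derivative wt (t, x)) (at (t + 0 * \<eta>))"
    using w_t[OF t x] by simp
  have "((\<lambda>\<epsilon>. t + \<epsilon> * \<eta>) has_real_derivative \<eta>) (at 0)"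
    by (auto intro!: derivative_eq_intros)
  from DERIV_chain2[OF w_t' this]
  have "(q has_real_derivative E * w (t, x) + wt (t, x) * \<eta>) (at 0)"
    unfolding q_def by (auto intro!: derivative_eq_intros)
  \<comment> \<open>Small \<epsilon> keeps the shifted time below \<open>T\<close> and, since
    \<theta> < \<kappa> strictly, preserves the condition
    \<open>\<theta> * c t < \<kappa>\<close>.\<close>
  moreover have "\<forall>\<^sub>F \<epsilon> in at_right 0. q 0 \<le> q \<epsilon>"
  proof -
    have "((\<lambda>\<epsilon>. t + \<epsilon> * \<eta>) \<longlongrightarrow> t + 0 * \<eta>) (at_right 0)" by (intro tendsto_intros)
    then have "\<forall>\<^sub>F \<epsilon> in at_right 0. t + \<epsilon> * \<eta> < T"
      using t by (intro order_tendstoD) auto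
    moreover have "((\<lambda>\<epsilon>. \<theta> * (1 + \<epsilon> * E)) \<longlongrightarrow> \<theta> * (1 + 0 * E)) (at_right 0)" by (intro tendsto_intros)
    then have "\<forall>\<^sub>F \<epsilon> in at_right 0. \<theta> * (1 + \<epsilon> * E) < \<kappa>"
      using \<kappa> by (intro order_tendstoD) auto
    moreover have "\<forall>\<^sub>F \<epsilon> in at_right (0 :: real). 0 < \<epsilon>"
      by (simp add: eventually_at_filter)
    ultimately show ?thesis
    proof eventually_elim
      case (elim \<epsilon>)
      then show ?case
        using time_rescaling_comparison[OF \<kappa>_pos, of \<epsilon> t x] t x
        by (simp add: q_def E_def \<eta>_def)
    qed
  qed
  ultimately have "0 \<le> E * w (t, x) + wt (t, x) * \<eta>"
  proof -
    assume q': "(q has_real_derivative E * w (t, x) + wt (t, x) * \<eta>) (at 0)"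
      and ev: "\<forall>\<^sub>F \<epsilon> in at_right 0. q 0 \<le> q \<epsilon>"
    have "((\<lambda>\<epsilon>. (q \<epsilon> - q 0) / (\<epsilon> - 0)) \<longlongrightarrow> E * w (t, x) + wt (t, x) * \<eta>) (at_right 0)"
      using DERIV_subset[OF q', of "{0<..}"] by (simp add: has_field_derivative_iff)
    then show ?thesis
    proof (rule tendsto_lowerbound)
      show "\<forall>\<^sub>F \<epsilon> in at_right 0. 0 \<le> (q \<epsilon> - q 0) / (\<epsilon> - 0)"
        using ev eventually_at_right_less[of 0] by eventually_elim simp
    qed simp
  qed
  then have "0 \<le> (E * w (t, x) + wt (t, x) * \<eta>) / E" by (simp add: E_def)
  \<comment> \<open>The quotient \<open>\<eta> / E\<close> is exactly
    \<open>K_theta \<kappa> t\<close>.\<close>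
  also have "\<dots> = w (t, x) + wt (t, x) * K_theta \<kappa> t"
    using \<kappa>_pos by (simp add: K_theta_def E_def \<eta>_def field_simps)
  finally show ?thesis .
qed

text \<open>The comparison requires \<theta> < \<kappa>; letting \<kappa> decrease to \<theta>
  recovers the sharp factor.\<close>

lemma time_derivative_lower_bound:
  assumes t: "0 < t" "t < T" and x: "a < x" "x < b"
  shows "- (w (t, x) / K_theta \<theta> t) \<le> wt (t, x)"
proof -
  have "((\<lambda>\<kappa>. w (t, x) + wt (t, x) * K_theta \<kappa> t) \<longlongrightarrow> w (t, x) + wt (t, x) * K_theta \<theta> t) (at_right \<theta>)"
    by (intro tendsto_intros K_theta_tendsto_right \<theta>_nonneg)
  then have "0 \<le> w (t, x) + wt (t, x) * K_theta \<theta> t"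
    by (rule tendsto_lowerbound)
      (use time_derivative_lower_bound_strict[OF _ t x] in \<open>auto simp: eventually_at_filter\<close>)
  then show ?thesis
    using K_theta_pos[OF \<theta>_nonneg t(1)] by (simp add: field_simps)
qed

end

section \<open>Test functions and regularized solutions\<close>

text \<open>Supplies the continuity of the time derivative up to the boundary, which the integration
  by parts needs. The modulus \<open>E\<close> is continuous and vanishes at the base point, since
  \<open>0 powr\<close> a positive exponent is 0.\<close>

lemma parabolic_holder_on_imp_continuous_on:
  assumes "parabolic_holder_on \<beta> S w" "0 < \<beta>"
  shows "continuous_on S w"
  unfolding continuous_on_def
proof
  obtain C where C: "\<And>t x s y. (t, x) \<in> S \<Longrightarrow> (s, y) \<in> S \<Longrightarrow>
      \<bar>w (t, x) - w (s, y)\<bar> \<le> C * (\<bar>t - s\<bar> powr (\<beta> / 2) + \<bar>x - y\<bar> powr \<beta>)"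
    using assms(1) unfolding parabolic_holder_on_def by blast
  fix z assume z: "z \<in> S"
  define E where "E = (\<lambda>v. C * (\<bar>fst v - fst z\<bar> powr (\<beta> / 2) + \<bar>snd v - snd z\<bar> powr \<beta>))"
  have "continuous_on S E"
    unfolding E_def using assms(2) by (intro continuous_intros continuous_on_powr') auto
  then have "(E \<longlongrightarrow> E z) (at z within S)" using z by (simp add: continuous_on_def)
  then have "(E \<longlongrightarrow> 0) (at z within S)" by (simp add: E_def)
  moreover have "\<forall>\<^sub>F v in at z within S. norm (w v - w z) \<le> E v"
    using C[of _ _ "fst z" "snd z"] z by (auto simp: eventually_at_filter E_def intro!: always_eventually)
  ultimately have "((\<lambda>v. w v - w z) \<longlongrightarrow> 0) (at z within S)"
    by (rule Lim_null_comparison[rotated])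
  then show "(w \<longlongrightarrow> w z) (at z within S)" by (simp add: LIM_zero_iff)
qed

lemma rho_pos: "0 \<le> lam \<Longrightarrow> 0 < x \<Longrightarrow> 0 < rho lam x"
  by (simp add: rho_def)

lemma continuous_on_rho: "continuous_on S (rho lam)"
  unfolding rho_def by (intro continuous_intros)

lemma Cc_infty_continuous_on: "\<phi> \<in> Cc_infty S \<Longrightarrow> continuous_on S \<phi>"
  unfolding Cc_infty_def smooth_on_def by (auto dest!: spec[of _ 0] intro: continuous_on_subset)

lemma Cc_infty_differentiable: "\<phi> \<in> Cc_infty S \<Longrightarrow> z \<in> S \<Longrightarrow> \<phi> differentiable (at z)"
  unfolding Cc_infty_def smooth_on_def by (auto dest!: spec[of _ "Suc 0"])

lemma Cc_infty_continuous_on_derivative: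
  "\<phi> \<in> Cc_infty S \<Longrightarrow> continuous_on S (\<lambda>z. frechet_derivative \<phi> (at z) v)"
proof -
  assume "\<phi> \<in> Cc_infty S"
  then obtain U where "S \<subseteq> U" "Ck_on (Suc 0) \<phi> U" unfolding Cc_infty_def smooth_on_def by blast
  then show ?thesis by (auto intro: continuous_on_subset)
qed

lemma Cc_infty_support:
  assumes "h \<in> Cc_infty S"
  obtains K where "compact K" "K \<subseteq> S" "\<And>x. x \<in> S - K \<Longrightarrow> h x = 0"
  using assms unfolding Cc_infty_def by blast

lemma Cc_infty_bounded:
  assumes "h \<in> Cc_infty S"
  obtains M where "\<And>x. x \<in> S \<Longrightarrow> \<bar>h x\<bar> \<le> M"
proof -
  obtain K where K: "compact K" "K \<subseteq> S" "\<And>x. x \<in> S - K \<Longrightarrow> h x = 0"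
    using Cc_infty_support[OF assms] by metis
  have "bounded (h ` K)"
    using Cc_infty_continuous_on[OF assms] K
    by (meson compact_continuous_image compact_imp_bounded continuous_on_subset)
  then obtain M where "\<And>x. x \<in> K \<Longrightarrow> \<bar>h x\<bar> \<le> M" by (auto simp: bounded_iff)
  then have "\<bar>h x\<bar> \<le> max M 0" if "x \<in> S" for x
    using K(3)[of x] that by (cases "x \<in> K") (auto simp: max.coboundedI1)
  then show ?thesis using that by blast
qed

lemma frechet_derivative_zero_outside_support:
  assumes "open S" "compact K" "\<And>z. z \<in> S - K \<Longrightarrow> \<phi> z = 0" "z \<in> S - K"
  shows "frechet_derivative \<phi> (at z) v = 0"
proof -
  have "open (S - K)" using assms by (simp add: compact_imp_closed open_Diff)
  then have "(\<phi> has_derivative (\<lambda>_. 0)) (at z)"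
    using has_derivative_transform_within_open[OF has_derivative_const[of 0] _ assms(4)] assms(3) by metis
  then show ?thesis by (metis frechet_derivative_at)
qed

lemma differentiable_imp_DERIV_fst:
  fixes \<phi> :: "real \<times> real \<Rightarrow> real"
  assumes "\<phi> differentiable (at (t, x))"
  shows "((\<lambda>s. \<phi> (s, x)) has_real_derivative frechet_derivative \<phi> (at (t, x)) (1, 0)) (at t)"
proof -
  let ?D = "frechet_derivative \<phi> (at (t, x))"
  have D: "(\<phi> has_derivative ?D) (at (t, x))"
    using assms by (simp add: frechet_derivative_works)
  have "((\<lambda>s. (s, x)) has_derivative (\<lambda>h. (h, 0))) (at t)"
    by (auto intro!: derivative_eq_intros)
  from has_derivative_compose[OF this D] have "((\<lambda>s. \<phi> (s, x)) has_derivative (\<lambda>h. ?D (h, 0))) (at t)" .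
  moreover have "(\<lambda>h. ?D (h, 0)) = (*) (?D (1, 0))"
  proof
    show "?D (h, 0) = ?D (1, 0) * h" for h
      using linear_scale[OF has_derivative_linear[OF D], of h "(1, 0)"] by simp
  qed
  ultimately show ?thesis unfolding has_field_derivative_def by simp
qed

section \<open>Pointwise lower bounds for the regularized source\<close>

text \<open>The set where \<open>h < c\<close> is open and null, hence empty.\<close>

lemma continuous_ge_if_AE_ge:
  fixes h :: "real \<Rightarrow> real"
  assumes "open S" "continuous_on S h" "AE x in lebesgue_on S. c \<le> h x" "x \<in> S"
  shows "c \<le> h x"
proof (rule ccontr)
  assume "\<not> c \<le> h x"
  then have "x \<in> S \<inter> h -` {..<c}" using assms(4) by auto
  moreover have "open (S \<inter> h -` {..<c})"
    using assms(1,2) by (intro continuous_open_preimage) auto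
  moreover have "AE x \<in> S \<inter> h -` {..<c} in lebesgue. x \<in> {}"
    using assms(1,3) by (subst (asm) AE_restrict_space_iff) auto
  ultimately show False using mem_closed_if_AE_lebesgue_open[of "S \<inter> h -` {..<c}" "{}" x] by auto
qed

lemma theta_nonneg: "0 \<le> theta lam g"
  by (simp add: theta_def)

text \<open>An essential infimum is minus the essential supremum of the negative, so
  \<open>le\<close> bounds the essential supremum of \<open>- h\<close> by \<theta>. Continuity of
  \<open>h\<close> upgrades this to every point.\<close>

lemma neg_theta_le:
  fixes h :: "real \<Rightarrow> real"
  assumes g: "(\<lambda>x. rho lam x * g x) \<in> Linf (lebesgue_on \<Omega>)"
    and h: "h \<in> Cc_infty {a<..<b}" "x \<in> {a<..<b}"
    and le: "min (essinf (lebesgue_on \<Omega>) (\<lambda>x. ereal (rho lam x * g x))) 0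
        \<le> essinf (lebesgue_on {a<..<b}) (\<lambda>x. ereal (h x))"
  shows "- theta lam g \<le> h x"
proof -
  define s where "s = esssup (lebesgue_on \<Omega>) (\<lambda>x. ereal (- (rho lam x * g x)))"
  have meas: "(\<lambda>x. rho lam x * g x) \<in> borel_measurable (lebesgue_on \<Omega>)"
    using g by (simp add: Linf_def)
  have "s \<le> Linf_norm (lebesgue_on \<Omega>) (\<lambda>x. rho lam x * g x)"
    unfolding s_def Linf_norm_def using meas by (intro esssup_mono) auto
  also have "\<dots> < \<infinity>" using g by (simp add: Linf_def)
  \<comment> \<open>\<open>real_of_ereal\<close> sends infinite values to 0, so
    \<open>s < \<infinity>\<close> has to be known first; the value minus infinity would be harmless
    because of the maximum with 0.\<close>
  finally have s: "max s 0 = ereal (theta lam g)"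
    unfolding theta_def s_def[symmetric] by (cases s) (auto simp: max_def zero_ereal_def)
  have "esssup (lebesgue_on {a<..<b}) (\<lambda>x. ereal (- h x)) \<le> max s 0"
    using le unfolding essinf_def s_def
    by (auto simp: min_def max_def split: if_splits)
  then have le': "esssup (lebesgue_on {a<..<b}) (\<lambda>x. ereal (- h x)) \<le> ereal (theta lam g)"
    by (simp only: s)
  have "AE x in lebesgue_on {a<..<b}. - theta lam g \<le> h x"
    using esssup_AE[of "\<lambda>x. ereal (- h x)" "lebesgue_on {a<..<b}"]
  proof eventually_elim
    case (elim x)
    from order_trans[OF this le'] show ?case by simp
  qed
  then show ?thesis
    using continuous_ge_if_AE_ge[OF _ Cc_infty_continuous_on[OF h(1)] _ h(2)] by simp
qed

text \<open>Adding \<open>1 / n\<close> leaves all derivatives unchanged and turns both factors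
  \<open>u + 1/n\<close> of the equation into the new unknown. The one-sided derivatives of the
  Hoelder class become two-sided in the interior.\<close>

lemma regularized_solution_parabolic_problem:
  assumes sol: "regularized_solution lam T n a b \<beta> v0 g u"
    and "0 < \<beta>" "0 \<le> lam" "0 < T" "0 < a" "a < b" "1 \<le> n" "0 \<le> \<theta>"
    and v0: "\<And>x. x \<in> \<Omega> \<Longrightarrow> 0 \<le> v0 x"
    and bound: "\<And>x. x \<in> {a<..<b} \<Longrightarrow> \<bar>rho lam x * g x\<bar> \<le> M"
    and lower: "\<And>x. x \<in> {a<..<b} \<Longrightarrow> - \<theta> \<le> rho lam x * g x"
  obtains ut ux uxx where
    "parabolic_problem T a b (1 / real n) M \<theta> (\<lambda>z. u z + 1 / real n) ut ux uxx (rho lam) (\<lambda>x. rho lam x * g x)"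
    "continuous_on ({0..T} \<times> {a..b}) ut"
proof -
  obtain ut ux uxx where
    d: "\<And>t x. t \<in> {0..T} \<Longrightarrow> x \<in> {a..b} \<Longrightarrow>
        ((\<lambda>s. u (s, x)) has_real_derivative ut (t, x)) (at t within {0..T}) \<and>
        ((\<lambda>y. u (t, y)) has_real_derivative ux (t, x)) (at x within {a..b}) \<and>
        ((\<lambda>y. ux (t, y)) has_real_derivative uxx (t, x)) (at x within {a..b})"
    and cont: "continuous_on ({0..T} \<times> {a..b}) u"
    and hold: "parabolic_holder_on \<beta> ({0..T} \<times> {a..b}) ut"
    using sol unfolding regularized_solution_def parabolic_C12_holder_def by blast
  have dt: "((\<lambda>s. u (s, x)) has_real_derivative ut (t, x)) (at t)"
    if "0 < t" "t < T" "a < x" "x < b" for t x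
    using d[of t x] that at_within_Icc_at[of 0 t T] by auto
  have dx: "((\<lambda>y. u (t, y)) has_real_derivative ux (t, x)) (at x)"
    if "0 < t" "t < T" "a < x" "x < b" for t x
    using d[of t x] that at_within_Icc_at[of a x b] by auto
  have dxx: "((\<lambda>y. ux (t, y)) has_real_derivative uxx (t, x)) (at x)"
    if "0 < t" "t < T" "a < x" "x < b" for t x
    using d[of t x] that at_within_Icc_at[of a x b] by auto
  \<comment> \<open>The equation is stated with the total operator \<open>deriv\<close>; it agrees
    with \<open>ux\<close> on the whole open interval, so it can be differentiated once
    more.\<close>
  have deriv2: "(deriv ^^ 2) (\<lambda>y. u (t, y)) x = uxx (t, x)"
    if t: "0 < t" "t < T" and x: "a < x" "x < b" for t x
  proof -
    have "(deriv (\<lambda>y. u (t, y)) has_real_derivative uxx (t, x)) (at x)"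
      by (rule has_field_derivative_transform_within_open[OF dxx[OF t x], of "{a<..<b}"])
        (use x dx[OF t] in \<open>auto intro!: DERIV_imp_deriv[symmetric]\<close>)
    then show ?thesis by (simp add: numeral_2_eq_2 DERIV_imp_deriv)
  qed
  have "parabolic_problem T a b (1 / real n) M \<theta> (\<lambda>z. u z + 1 / real n) ut ux uxx
      (rho lam) (\<lambda>x. rho lam x * g x)"
  proof
    show "ut (t, x) = rho lam x * (u (t, x) + 1 / real n) * uxx (t, x) +
        rho lam x * g x * (u (t, x) + 1 / real n)"
      if "0 < t" "t < T" "a < x" "x < b" for t x
      using sol that DERIV_imp_deriv[OF dt[OF that]] deriv2[OF that]
      unfolding regularized_solution_def by auto
    show "1 / real n \<le> u (0, x) + 1 / real n" if "x \<in> {a..b}" for x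
    proof -
      \<comment> \<open>The initial datum is prescribed only on the open interval; at the endpoints
        the lateral condition at time 0 is used.\<close>
      have "0 \<le> u (0, x)"
        using sol that v0[of x] \<open>0 < a\<close> \<open>0 < T\<close> unfolding regularized_solution_def
        by (cases "x = a \<or> x = b") auto
      then show ?thesis by simp
    qed
    show "u (t, a) + 1 / real n = 1 / real n \<and> u (t, b) + 1 / real n = 1 / real n" if "t \<in> {0..T}" for t
      using sol that unfolding regularized_solution_def by auto
    show "continuous_on ({0..T} \<times> {a..b}) (\<lambda>z. u z + 1 / real n)"
      by (intro continuous_intros cont)
    show "((\<lambda>s. u (s, x) + 1 / real n) has_real_derivative ut (t, x)) (at t)"
      if "0 < t" "t < T" "a < x" "x < b" for t x
      using DERIV_add[OF dt[OF that] DERIV_const[of "1 / real n"]] by simp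
    show "((\<lambda>y. u (t, y) + 1 / real n) has_real_derivative ux (t, x)) (at x)"
      if "0 < t" "t < T" "a < x" "x < b" for t x
      using DERIV_add[OF dx[OF that] DERIV_const[of "1 / real n"]] by simp
    show "\<bar>rho lam x * g x\<bar> \<le> M" "- \<theta> \<le> rho lam x * g x" "0 < rho lam x" if "a < x" "x < b" for x
      using bound[of x] lower[of x] rho_pos[of lam x] that \<open>0 < a\<close> \<open>0 \<le> lam\<close> by auto
  qed (use \<open>a < b\<close> \<open>1 \<le> n\<close> \<open>0 \<le> \<theta>\<close> dxx in auto)
  then show ?thesis using that parabolic_holder_on_imp_continuous_on[OF hold \<open>0 < \<beta>\<close>] by blast
qed

section \<open>Integration by parts and local convergence\<close>

text \<open>The integrand is the time derivative of \<open>w * \<phi>\<close>, so each slice with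
  fixed \<open>x\<close> integrates to a difference of endpoint values, where \<phi> vanishes.
  Fubini then gives the claim.\<close>

lemma integral_by_parts_time_box:
  fixes w wt \<phi> \<phi>t :: "real \<times> real \<Rightarrow> real"
    and p q \<alpha> \<beta> :: real
  defines "B \<equiv> {p..q} \<times> {\<alpha>..\<beta>}"
  assumes "p \<le> q"
    and cont: "continuous_on B w" "continuous_on B wt" "continuous_on B \<phi>" "continuous_on B \<phi>t"
    and w: "\<And>t x. (t, x) \<in> B \<Longrightarrow> ((\<lambda>s. w (s, x)) has_real_derivative wt (t, x)) (at t)"
    and \<phi>: "\<And>t x. (t, x) \<in> B \<Longrightarrow> ((\<lambda>s. \<phi> (s, x)) has_real_derivative \<phi>t (t, x)) (at t)"
    and zero: "\<And>x. x \<in> {\<alpha>..\<beta>} \<Longrightarrow> \<phi> (p, x) = 0 \<and> \<phi> (q, x) = 0"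
  shows "(LINT z|lebesgue_on B. wt z * \<phi> z + w z * \<phi>t z) = 0"
proof -
  define G where "G = (\<lambda>z. wt z * \<phi> z + w z * \<phi>t z)"
  define H where "H = (\<lambda>z. indicator B z *\<^sub>R G z)"
  have G_cont: "continuous_on B G" unfolding G_def by (intro continuous_intros cont)
  have B: "compact B" unfolding B_def by (intro compact_Times compact_Icc)
  have int: "integrable lborel H"
    unfolding H_def by (rule borel_integrable_compact[OF B G_cont])
  have slice: "(LINT t|lborel. H (t, x)) = 0" for x
  proof (cases "x \<in> {\<alpha>..\<beta>}")
    case True
    have "(LINT t|lborel. indicator {p..q} t *\<^sub>R G (t, x)) = w (q, x) * \<phi> (q, x) - w (p, x) * \<phi> (p, x)"
    proof (rule integral_FTC_atLeastAtMost[OF \<open>p \<le> q\<close>])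
      show "((\<lambda>t. w (t, x) * \<phi> (t, x)) has_vector_derivative G (t, x)) (at t within {p..q})"
        if "p \<le> t" "t \<le> q" for t
      proof -
        have "(t, x) \<in> B" using True that by (simp add: B_def)
        from DERIV_mult[OF w[OF this] \<phi>[OF this]] show ?thesis
          by (simp add: G_def algebra_simps has_real_derivative_iff_has_vector_derivative
              has_vector_derivative_at_within)
      qed
      show "continuous_on {p..q} (\<lambda>t. G (t, x))"
        by (rule continuous_on_compose2[OF G_cont]) (use True in \<open>auto simp: B_def intro!: continuous_intros\<close>)
    qed
    then show ?thesis using zero[OF True] True by (simp add: H_def B_def indicator_times)
  qed (simp add: H_def B_def indicator_times)
  have "(LINT z|lebesgue_on B. G z) = (LINT z|lebesgue. H z)"
    unfolding H_def using B by (subst integral_restrict_space) (auto simp: lmeasurable_compact fmeasurableD)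
  \<comment> \<open>Passing from the completed measure to \<open>lborel\<close> makes the product
    structure available for Fubini.\<close>
  also have "\<dots> = (LINT z|lborel. H z)"
    using int by (intro integral_completion) auto
  also have "\<dots> = (LINT z|(lborel \<Otimes>\<^sub>M lborel). (\<lambda>(t, x). H (t, x)) z)"
    by (simp add: lborel_prod)
  also have "\<dots> = (LINT x|lborel. LINT t|lborel. H (t, x))"
    by (rule lborel_pair.integral_snd[symmetric]) (use int in \<open>simp add: lborel_prod\<close>)
  finally show ?thesis by (simp add: slice G_def)
qed

section \<open>Weighted space-time measure and local \<open>L\<^sup>1\<close> convergence on compact
  sets\<close>

lemma restrict_space_density:
  assumes "f \<in> borel_measurable M" "B \<inter> space M \<in> sets M"
  shows "restrict_space (density M f) B = density (restrict_space M B) f"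
proof (rule measure_eqI)
  fix A assume "A \<in> sets (restrict_space (density M f) B)"
  then have A: "A \<in> sets (restrict_space M B)" by (simp add: sets_restrict_space)
  then have "A \<in> sets M" "A \<subseteq> B"
    using assms(2) by (auto simp: sets_restrict_space_iff)
  then show "emeasure (restrict_space (density M f) B) A = emeasure (density (restrict_space M B) f) A"
    using assms A
    by (simp add: emeasure_restrict_space emeasure_density nn_integral_restrict_space
        measurable_restrict_space1)
      (auto intro!: nn_integral_cong simp: indicator_def)
qed (simp add: sets_restrict_space)

context
  fixes lam T :: real and K :: "(real \<times> real) set"
  assumes lam: "0 \<le> lam" and K: "compact K" "K \<subseteq> QT T"
begin

lemma K_lebesgue: "K \<in> sets lebesgue"
  using K by (simp add: lmeasurable_compact fmeasurableD)

lemma restrict_space_lebesgue_QT: "restrict_space (lebesgue_on (QT T)) K = lebesgue_on K"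
  using K by (simp add: restrict_restrict_space inf.absorb2 K_lebesgue borel_open open_Times)

lemma restrict_space_dt_nu:
  "restrict_space (dt_nu lam T) K = density (lebesgue_on K) (\<lambda>z. ennreal (1 / rho lam (snd z)))"
proof -
  have "(\<lambda>z. 1 / rho lam (snd z)) \<in> borel_measurable (lebesgue_on (QT T))"
  proof (rule continuous_imp_measurable_on_sets_lebesgue)
    show "continuous_on (QT T) (\<lambda>z. 1 / rho lam (snd z))"
      by (intro continuous_intros continuous_on_compose2[OF continuous_on_rho[of UNIV]])
        (use rho_pos[OF lam] in fastforce)+
  qed (simp add: borel_open open_Times)
  moreover have "K \<inter> space (lebesgue_on (QT T)) \<in> sets (lebesgue_on (QT T))"
    using K K_lebesgue by (auto simp: sets_restrict_space image_iff)
  ultimately show ?thesis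
    unfolding dt_nu_def by (simp add: split_def restrict_space_density restrict_space_lebesgue_QT)
qed

lemma rho_pos_on_K: "z \<in> K \<Longrightarrow> 0 < rho lam (snd z)"
  using K rho_pos[OF lam, of "snd z"] by auto

lemma rho_measurable_on_K: "(\<lambda>z. 1 / rho lam (snd z)) \<in> borel_measurable (lebesgue_on K)"
proof (rule continuous_imp_measurable_on_sets_lebesgue[OF _ K_lebesgue])
  show "continuous_on K (\<lambda>z. 1 / rho lam (snd z))"
    by (intro continuous_intros continuous_on_compose2[OF continuous_on_rho[of UNIV]])
      (auto dest: rho_pos_on_K)
qed

lemma Lp_1_dt_nu_iff:
  "f \<in> Lp 1 (restrict_space (dt_nu lam T) K) \<longleftrightarrow>
    f \<in> borel_measurable (lebesgue_on K) \<and> integrable (lebesgue_on K) (\<lambda>z. f z / rho lam (snd z))"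
proof -
  have nn: "AE z in lebesgue_on K. 0 \<le> 1 / rho lam (snd z)"
    by (intro AE_I2) (auto dest!: rho_pos_on_K)
  have "integrable (lebesgue_on K) (\<lambda>z. 1 / rho lam (snd z) * \<bar>f z\<bar>) \<longleftrightarrow>
      integrable (lebesgue_on K) (\<lambda>z. f z / rho lam (snd z))"
    if f: "f \<in> borel_measurable (lebesgue_on K)"
  proof -
    have "(\<lambda>z. f z * (1 / rho lam (snd z))) \<in> borel_measurable (lebesgue_on K)"
      by (intro borel_measurable_times f rho_measurable_on_K)
    then have "integrable (lebesgue_on K) (\<lambda>z. norm (f z / rho lam (snd z))) \<longleftrightarrow>
        integrable (lebesgue_on K) (\<lambda>z. f z / rho lam (snd z))"
      by (intro integrable_norm_iff) simp
    moreover have "integrable (lebesgue_on K) (\<lambda>z. norm (f z / rho lam (snd z))) \<longleftrightarrow>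
        integrable (lebesgue_on K) (\<lambda>z. 1 / rho lam (snd z) * \<bar>f z\<bar>)"
      by (rule Bochner_Integration.integrable_cong) (auto dest!: rho_pos_on_K)
    ultimately show ?thesis by simp
  qed
  then show ?thesis
    unfolding Lp_def restrict_space_dt_nu
    using integrable_density[OF _ rho_measurable_on_K nn, of "\<lambda>z. \<bar>f z\<bar>"] by auto
qed

lemma Lp_norm_1_dt_nu:
  assumes "f \<in> borel_measurable (lebesgue_on K)"
  shows "Lp_norm 1 (restrict_space (dt_nu lam T) K) f = (LINT z|lebesgue_on K. \<bar>f z / rho lam (snd z)\<bar>)"
proof -
  have nn: "AE z in lebesgue_on K. 0 \<le> 1 / rho lam (snd z)"
    by (intro AE_I2) (auto dest!: rho_pos_on_K)
  have "(LINT z|restrict_space (dt_nu lam T) K. \<bar>f z\<bar>) = (LINT z|lebesgue_on K. 1 / rho lam (snd z) * \<bar>f z\<bar>)"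
    unfolding restrict_space_dt_nu
    using integral_density[OF _ rho_measurable_on_K nn, of "\<lambda>z. \<bar>f z\<bar>"] assms by simp
  also have "\<dots> = (LINT z|lebesgue_on K. \<bar>f z / rho lam (snd z)\<bar>)"
    by (rule Bochner_Integration.integral_cong) (auto dest!: rho_pos_on_K)
  finally show ?thesis by (simp add: Lp_norm_def)
qed

text \<open>Write \<open>f * \<psi>\<close> as \<open>(\<psi> * rho) * (f / rho)\<close>: the first
  factor is continuous, hence bounded on \<open>K\<close>, and the second is integrable by the
  weighted hypothesis.\<close>

lemma integrable_mult_bounded:
  assumes "f \<in> Lp 1 (restrict_space (dt_nu lam T) K)" "continuous_on K \<psi>"
  shows "integrable (lebesgue_on K) (\<lambda>z. f z * \<psi> z)"
    and "\<And>C. (\<And>z. z \<in> K \<Longrightarrow> \<bar>\<psi> z * rho lam (snd z)\<bar> \<le> C) \<Longrightarrow>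
      \<bar>LINT z|lebesgue_on K. f z * \<psi> z\<bar> \<le> C * (LINT z|lebesgue_on K. \<bar>f z / rho lam (snd z)\<bar>)"
proof -
  let ?r = "\<lambda>z::real\<times>real. rho lam (snd z)"
  have f: "f \<in> borel_measurable (lebesgue_on K)" and int: "integrable (lebesgue_on K) (\<lambda>z. f z / ?r z)"
    using assms(1) by (auto simp: Lp_1_dt_nu_iff)
  have meas: "(\<lambda>z. f z * \<psi> z) \<in> borel_measurable (lebesgue_on K)"
    using f continuous_imp_measurable_on_sets_lebesgue[OF assms(2) K_lebesgue] by simp
  have bound: "\<bar>f z * \<psi> z\<bar> \<le> C * \<bar>f z / ?r z\<bar>"
    if "z \<in> K" "\<bar>\<psi> z * ?r z\<bar> \<le> C" for z C
  proof -
    have "0 < ?r z" using rho_pos_on_K that by blast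
    then have "\<bar>f z * \<psi> z\<bar> = \<bar>\<psi> z * ?r z\<bar> * \<bar>f z / ?r z\<bar>" by (simp add: abs_mult)
    also have "\<dots> \<le> C * \<bar>f z / ?r z\<bar>" using that by (intro mult_right_mono) auto
    finally show ?thesis .
  qed
  have intC: "integrable (lebesgue_on K) (\<lambda>z. C * \<bar>f z / ?r z\<bar>)" for C
    using int by (intro integrable_mult_right integrable_abs)
  have "continuous_on K (\<lambda>z. \<psi> z * ?r z)"
    by (intro continuous_intros assms(2) continuous_on_compose2[OF continuous_on_rho[of UNIV]]) auto
  then have "bounded ((\<lambda>z. \<psi> z * ?r z) ` K)"
    using K(1) compact_continuous_image compact_imp_bounded by blast
  then obtain C where C: "\<And>z. z \<in> K \<Longrightarrow> \<bar>\<psi> z * ?r z\<bar> \<le> C" by (auto simp: bounded_iff)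
  show int': "integrable (lebesgue_on K) (\<lambda>z. f z * \<psi> z)"
  proof (rule Bochner_Integration.integrable_bound[OF intC[of C] meas], rule AE_I2)
    fix z assume "z \<in> space (lebesgue_on K)"
    then have "\<bar>f z * \<psi> z\<bar> \<le> C * \<bar>f z / ?r z\<bar>" using bound C by simp
    then show "norm (f z * \<psi> z) \<le> norm (C * \<bar>f z / ?r z\<bar>)"
      unfolding real_norm_def by linarith
  qed
  show "\<bar>LINT z|lebesgue_on K. f z * \<psi> z\<bar> \<le> C * (LINT z|lebesgue_on K. \<bar>f z / ?r z\<bar>)"
    if C: "\<And>z. z \<in> K \<Longrightarrow> \<bar>\<psi> z * ?r z\<bar> \<le> C" for C
  proof -
    have "\<bar>LINT z|lebesgue_on K. f z * \<psi> z\<bar> \<le> (LINT z|lebesgue_on K. \<bar>f z * \<psi> z\<bar>)"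
      using integral_norm_bound[of "lebesgue_on K" "\<lambda>z. f z * \<psi> z"] unfolding real_norm_def .
    also have "\<dots> \<le> (LINT z|lebesgue_on K. C * \<bar>f z / ?r z\<bar>)"
    proof (rule integral_mono)
      show "\<bar>f z * \<psi> z\<bar> \<le> C * \<bar>f z / ?r z\<bar>" if "z \<in> space (lebesgue_on K)" for z
        using bound[of z C] C[of z] that by simp
    qed (intro integrable_abs int' intC)+
    finally show ?thesis by (simp only: integral_mult_right_zero)
  qed
qed

text \<open>The previous bound, applied to \<open>f n - h\<close> with one constant \<open>C\<close>
  for all \<open>n\<close>, controls the error by the weighted norm.\<close>

lemma Lp_tendsto_1_imp_integral_tendsto:
  assumes lim: "Lp_tendsto 1 (restrict_space (dt_nu lam T) K) f h" and \<psi>: "continuous_on K \<psi>"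
  shows "(\<lambda>n. LINT z|lebesgue_on K. f n z * \<psi> z) \<longlonglongrightarrow> (LINT z|lebesgue_on K. h z * \<psi> z)"
proof -
  let ?r = "\<lambda>z::real\<times>real. rho lam (snd z)" and ?N = "restrict_space (dt_nu lam T) K"
  have h: "h \<in> Lp 1 ?N" and f: "\<forall>\<^sub>F n in sequentially. f n \<in> Lp 1 ?N"
    and norm: "(\<lambda>n. Lp_norm 1 ?N (\<lambda>z. f n z - h z)) \<longlonglongrightarrow> 0"
    using lim by (auto simp: Lp_tendsto_def)
  have "continuous_on K (\<lambda>z. \<psi> z * ?r z)"
    by (intro continuous_intros \<psi> continuous_on_compose2[OF continuous_on_rho[of UNIV]]) auto
  then have "bounded ((\<lambda>z. \<psi> z * ?r z) ` K)"
    using K(1) compact_continuous_image compact_imp_bounded by blast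
  then obtain C where C: "\<And>z. z \<in> K \<Longrightarrow> \<bar>\<psi> z * ?r z\<bar> \<le> C" by (auto simp: bounded_iff)
  have "\<forall>\<^sub>F n in sequentially. norm ((LINT z|lebesgue_on K. f n z * \<psi> z) - (LINT z|lebesgue_on K. h z * \<psi> z))
      \<le> C * Lp_norm 1 ?N (\<lambda>z. f n z - h z)"
    using f
  proof eventually_elim
    case (elim n)
    have diff: "(\<lambda>z. f n z - h z) \<in> Lp 1 ?N"
      using elim h by (auto simp: Lp_1_dt_nu_iff diff_divide_distrib)
    have "(LINT z|lebesgue_on K. f n z * \<psi> z) - (LINT z|lebesgue_on K. h z * \<psi> z)
        = (LINT z|lebesgue_on K. (f n z - h z) * \<psi> z)"
      using integrable_mult_bounded(1)[OF elim \<psi>] integrable_mult_bounded(1)[OF h \<psi>]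
      by (simp add: left_diff_distrib)
    also have "\<bar>\<dots>\<bar> \<le> C * (LINT z|lebesgue_on K. \<bar>(f n z - h z) / ?r z\<bar>)"
      by (rule integrable_mult_bounded(2)[OF diff \<psi> C])
    also have "\<dots> = C * Lp_norm 1 ?N (\<lambda>z. f n z - h z)"
      using diff by (subst Lp_norm_1_dt_nu) (auto simp: Lp_1_dt_nu_iff)
    finally show ?case by simp
  qed
  moreover have "(\<lambda>n. C * Lp_norm 1 ?N (\<lambda>z. f n z - h z)) \<longlonglongrightarrow> 0"
    using tendsto_mult_left[OF norm, of C] by simp
  ultimately have "(\<lambda>n. (LINT z|lebesgue_on K. f n z * \<psi> z) - (LINT z|lebesgue_on K. h z * \<psi> z)) \<longlonglongrightarrow> 0"
    by (rule Lim_null_comparison)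
  then show ?thesis by (simp add: LIM_zero_iff)
qed

end

section \<open>Boxes around compact supports\<close>

lemma compact_subset_open_interval:
  fixes C :: "real set"
  assumes "compact C" "C \<subseteq> {l<..<r}" "l < r"
  obtains p q where "l < p" "p < q" "q < r" "C \<subseteq> {p<..<q}"
proof (cases "C = {}")
  case True
  have "l < (2 * l + r) / 3" "(2 * l + r) / 3 < (l + 2 * r) / 3" "(l + 2 * r) / 3 < r"
    using assms(3) by auto
  then show ?thesis using that True by blast
next
  case False
  obtain m where m: "m \<in> C" "\<And>x. x \<in> C \<Longrightarrow> m \<le> x"
    using compact_attains_inf[OF assms(1) False] by blast
  obtain M where M: "M \<in> C" "\<And>x. x \<in> C \<Longrightarrow> x \<le> M"
    using compact_attains_sup[OF assms(1) False] by blast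
  have bounds: "l < m" "m \<le> M" "M < r" using m M assms(2) by auto
  have "C \<subseteq> {(l + m) / 2<..<(M + r) / 2}"
  proof
    fix x assume "x \<in> C"
    with m(2) M(2) have "m \<le> x" "x \<le> M" by auto
    then show "x \<in> {(l + m) / 2<..<(M + r) / 2}" using bounds by auto
  qed
  then show ?thesis using bounds by (intro that[of "(l + m) / 2" "(M + r) / 2"]) auto
qed

lemma compact_subset_box:
  assumes K: "compact K" "K \<subseteq> QT T" and "0 < T"
  obtains p q \<alpha> \<beta> where "0 < p" "p < q" "q < T" "0 < \<alpha>" "\<alpha> < \<beta>" "K \<subseteq> {p<..<q} \<times> {\<alpha><..<\<beta>}"
proof -
  have cf: "compact (fst ` K)" and cs: "compact (snd ` K)"
    using K(1) by (auto intro!: compact_continuous_image continuous_intros)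
  have "fst ` K \<subseteq> {0<..<T}" using K(2) by auto
  from compact_subset_open_interval[OF cf this \<open>0 < T\<close>]
  obtain p q where pq: "0 < p" "p < q" "q < T" "fst ` K \<subseteq> {p<..<q}" by metis
  obtain R where R: "\<And>x. x \<in> snd ` K \<Longrightarrow> \<bar>x\<bar> \<le> R"
    using compact_imp_bounded[OF cs] by (auto simp: bounded_iff)
  \<comment> \<open>The spatial domain is unbounded, so an artificial right end beyond
    \<open>K\<close> is introduced; the maximum with 0 covers an empty \<open>K\<close>.\<close>
  have "snd ` K \<subseteq> {0<..<max R 0 + 1}"
  proof
    fix x assume x: "x \<in> snd ` K"
    then have "0 < x" using K(2) by auto
    moreover have "x \<le> R" using R[OF x] by simp
    ultimately show "x \<in> {0<..<max R 0 + 1}" by simp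
  qed
  from compact_subset_open_interval[OF cs this]
  obtain \<alpha> \<beta> where "0 < \<alpha>" "\<alpha> < \<beta>" "snd ` K \<subseteq> {\<alpha><..<\<beta>}" by (metis add_nonneg_pos max.cobounded2 zero_less_one)
  moreover have "K \<subseteq> fst ` K \<times> snd ` K" by (auto simp: rev_image_eqI)
  ultimately show ?thesis using pq by (intro that[of p q \<alpha> \<beta>]) (auto dest!: subsetD)
qed

lemma integral_lebesgue_on_subset:
  fixes f :: "'a::euclidean_space \<Rightarrow> real"
  assumes "A \<in> sets lebesgue" "B \<in> sets lebesgue" "B \<subseteq> A" "\<And>z. z \<in> A - B \<Longrightarrow> f z = 0"
  shows "(LINT z|lebesgue_on A. f z) = (LINT z|lebesgue_on B. f z)"
proof -
  have "(LINT z|lebesgue. indicator A z *\<^sub>R f z) = (LINT z|lebesgue. indicator B z *\<^sub>R f z)"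
    using assms(3,4) by (intro Bochner_Integration.integral_cong) (auto simp: indicator_def)
  then show ?thesis using assms(1,2) by (simp add: integral_restrict_space)
qed

text \<open>The pointwise bound on \<open>wt\<close> is multiplied by \<phi> \<ge> 0 and
  \<open>w * \<phi>t\<close> is added. The right-hand side becomes the time derivative of
  \<open>w * \<phi>\<close>, whose integral over the box is zero.\<close>

lemma (in parabolic_problem) integral_lower_bound:
  fixes p q \<alpha> \<beta> :: real
  defines "B \<equiv> {p..q} \<times> {\<alpha>..\<beta>}"
  assumes box: "0 < p" "p \<le> q" "q < T" "a < \<alpha>" "\<beta> < b"
    and wt: "continuous_on ({0..T} \<times> {a..b}) wt"
    and \<phi>: "continuous_on B \<phi>" "continuous_on B \<phi>t"
    and \<phi>_nonneg: "\<And>z. z \<in> B \<Longrightarrow> 0 \<le> \<phi> z"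
    and deriv: "\<And>t x. (t, x) \<in> B \<Longrightarrow> ((\<lambda>s. \<phi> (s, x)) has_real_derivative \<phi>t (t, x)) (at t)"
    and zero: "\<And>x. x \<in> {\<alpha>..\<beta>} \<Longrightarrow> \<phi> (p, x) = 0 \<and> \<phi> (q, x) = 0"
  shows "0 \<le> (LINT z|lebesgue_on B. w z * (\<phi> z / K_theta \<theta> (fst z) - \<phi>t z))"
proof -
  have B_cbox: "B = cbox (p, \<alpha>) (q, \<beta>)" by (simp add: B_def cbox_Pair_eq)
  have sub: "B \<subseteq> {0..T} \<times> {a..b}" using box by (auto simp: B_def)
  note w_B = continuous_on_subset[OF w_cont sub]
  note wt_B = continuous_on_subset[OF wt sub]
  have pos: "0 < K_theta \<theta> (fst z)" if "z \<in> B" for z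
    using that box \<theta>_nonneg by (intro K_theta_pos) (auto simp: B_def)
  have K_cont: "continuous_on B (\<lambda>z. K_theta \<theta> (fst z))"
    by (rule continuous_on_compose2[OF continuous_on_K_theta[of UNIV]]) (auto intro!: continuous_intros)
  have int1: "integrable (lebesgue_on B) (\<lambda>z. wt z * \<phi> z + w z * \<phi>t z)"
    unfolding B_cbox
    by (rule continuous_imp_integrable) (intro continuous_intros w_B[unfolded B_cbox] wt_B[unfolded B_cbox] \<phi>[unfolded B_cbox])
  have "continuous_on B (\<lambda>z. - (w z * (\<phi> z / K_theta \<theta> (fst z) - \<phi>t z)))"
    by (intro continuous_intros w_B \<phi> K_cont ballI) (use pos in force)
  then have int2: "integrable (lebesgue_on B) (\<lambda>z. - (w z * (\<phi> z / K_theta \<theta> (fst z) - \<phi>t z)))"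
    unfolding B_cbox by (rule continuous_imp_integrable)
  have "(LINT z|lebesgue_on B. - (w z * (\<phi> z / K_theta \<theta> (fst z) - \<phi>t z)))
      \<le> (LINT z|lebesgue_on B. wt z * \<phi> z + w z * \<phi>t z)"
  proof (rule integral_mono[OF int2 int1])
    fix z assume "z \<in> space (lebesgue_on B)"
    then have z: "z \<in> B" by simp
    then have "- (w z / K_theta \<theta> (fst z)) \<le> wt z"
      using time_derivative_lower_bound[of "fst z" "snd z"] box by (auto simp: B_def)
    from mult_right_mono[OF this \<phi>_nonneg[OF z]]
    show "- (w z * (\<phi> z / K_theta \<theta> (fst z) - \<phi>t z)) \<le> wt z * \<phi> z + w z * \<phi>t z"
      by (simp add: algebra_simps)
  qed
  also have "\<dots> = 0"
    unfolding B_def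
    by (rule integral_by_parts_time_box[OF box(2)])
      (use w_B wt_B \<phi> deriv zero box w_t in \<open>auto simp: B_def\<close>)
  finally show ?thesis by simp
qed

lemma Lp_loc_1_of_Lp_loc_dt_nu:
  assumes "0 \<le> lam" "u \<in> Lp_loc 1 (dt_nu lam T)" "continuous_on (QT T) \<psi>"
  shows "(\<lambda>z. u z * \<psi> z) \<in> Lp_loc 1 (lebesgue_on (QT T))"
  unfolding Lp_loc_def
proof (intro CollectI allI impI)
  fix K assume "compact K \<and> K \<subseteq> space (lebesgue_on (QT T))"
  then have K: "compact K" "K \<subseteq> QT T" by auto
  have u: "u \<in> Lp 1 (restrict_space (dt_nu lam T) K)"
    using assms(2) K by (auto simp: Lp_loc_def dt_nu_def)
  have "integrable (lebesgue_on K) (\<lambda>z. u z * \<psi> z)"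
    by (rule integrable_mult_bounded(1)[OF assms(1) K u continuous_on_subset[OF assms(3) K(2)]])
  then show "(\<lambda>z. u z * \<psi> z) \<in> Lp 1 (restrict_space (lebesgue_on (QT T)) K)"
    unfolding restrict_space_lebesgue_QT[OF assms(1) K] Lp_def
    using integrable_abs by fastforce
qed

section \<open>Passage to the limit in the tested inequality\<close>

theorem proposition1p5:
  fixes lam \<delta> T :: real and g u0 :: "real \<Rightarrow> real" and u :: "real \<times> real \<Rightarrow> real"
  assumes "0 \<le> lam" and "0 < T"
    and "hypothesis_H lam \<delta> g u0"
    and "constructed_weak_solution lam \<delta> T g u0 u"
  shows "distr_deriv_ge (QT T) dir_t u (\<lambda>(t, x). - (u (t, x) / K_theta (theta lam g) t))"
proof -
  define \<theta> where "\<theta> = theta lam g"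
  have \<theta>: "0 \<le> \<theta>" by (simp add: \<theta>_def theta_nonneg)
  have g: "(\<lambda>x. rho lam x * g x) \<in> Linf (lebesgue_on \<Omega>)" and "\<delta> < 1"
    using assms(3) by (auto simp: hypothesis_H_def)
  obtain a b r \<beta> v0 gn un \<sigma> where
    adm: "admissible_data lam \<delta> g u0 a b r \<beta> v0 gn"
    and sol: "\<And>n. 1 \<le> n \<Longrightarrow> regularized_solution lam T n (a n) (b n) (\<beta> n) (v0 n) (gn n) (un n)"
    and \<sigma>: "strict_mono \<sigma>" "1 \<le> \<sigma> 0"
    and lim_q: "\<forall>q\<in>{\<delta><..<3}. Lp_loc_tendsto q (dt_nu lam T) (\<lambda>k. un (\<sigma> k)) u"
    using assms(4) unfolding constructed_weak_solution_def by blast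
  \<comment> \<open>The exponent 1 is admissible because \<delta> < 1 < 3.\<close>
  have lim: "Lp_tendsto 1 (restrict_space (dt_nu lam T) K) (\<lambda>k. un (\<sigma> k)) u"
    if "compact K" "K \<subseteq> QT T" for K
    using lim_q \<open>\<delta> < 1\<close> that by (auto simp: Lp_loc_tendsto_def dt_nu_def)
  have u_loc: "u \<in> Lp_loc 1 (dt_nu lam T)"
    using lim by (auto simp: Lp_loc_def Lp_tendsto_def dt_nu_def)
  have K_pos: "0 < K_theta \<theta> (fst z)" if "z \<in> QT T" for z
    using that \<theta> by (intro K_theta_pos) auto
  have K_cont: "continuous_on S (\<lambda>z. K_theta \<theta> (fst z))" for S :: "(real \<times> real) set"
    by (rule continuous_on_compose2[OF continuous_on_K_theta[of UNIV]]) (auto intro!: continuous_intros)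
  have "u \<in> Lp_loc 1 (lebesgue_on (QT T))"
    using Lp_loc_1_of_Lp_loc_dt_nu[OF assms(1) u_loc continuous_on_const[of _ 1]] by simp
  moreover have "(\<lambda>z. u z * - (1 / K_theta \<theta> (fst z))) \<in> Lp_loc 1 (lebesgue_on (QT T))"
    by (rule Lp_loc_1_of_Lp_loc_dt_nu[OF assms(1) u_loc])
      (intro continuous_intros K_cont ballI, use K_pos in force)
  then have "(\<lambda>(t, x). - (u (t, x) / K_theta \<theta> t)) \<in> Lp_loc 1 (lebesgue_on (QT T))"
    by (simp add: split_def)
  moreover have "(LINT z|lebesgue_on (QT T). (\<lambda>(t, x). - (u (t, x) / K_theta \<theta> t)) z * \<phi> z)
      \<le> - (LINT z|lebesgue_on (QT T). u z * frechet_derivative \<phi> (at z) dir_t)"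
    if \<phi>: "\<phi> \<in> Cc_infty (QT T)" and \<phi>_nonneg: "\<And>z. z \<in> QT T \<Longrightarrow> 0 \<le> \<phi> z" for \<phi>
  proof -
    define \<phi>t where "\<phi>t = (\<lambda>z. frechet_derivative \<phi> (at z) dir_t)"
    \<comment> \<open>The claim amounts to nonnegativity of the integral of
      \<open>u * \<psi>\<close>, so a single continuous weight carries the whole limit.\<close>
    define \<psi> where "\<psi> = (\<lambda>z. \<phi> z / K_theta \<theta> (fst z) - \<phi>t z)"
    obtain C where C: "compact C" "C \<subseteq> QT T" "\<And>z. z \<in> QT T - C \<Longrightarrow> \<phi> z = 0"
      by (rule Cc_infty_support[OF \<phi>]) (rule that)
    obtain p q \<alpha> \<gamma> where box: "0 < p" "p < q" "q < T" "0 < \<alpha>" "\<alpha> < \<gamma>"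
      and C_box: "C \<subseteq> {p<..<q} \<times> {\<alpha><..<\<gamma>}"
      using compact_subset_box[OF C(1,2) assms(2)] by metis
    \<comment> \<open>The support \<open>C\<close> lies in the interior of \<open>B\<close>, so
      \<phi> vanishes at the times \<open>p\<close> and \<open>q\<close>.\<close>
    define B where "B = {p..q} \<times> {\<alpha>..\<gamma>}"
    have B: "compact B" "B \<subseteq> QT T" "C \<subseteq> B"
      using box C_box by (auto simp: B_def intro!: compact_Times)
    have QT_open: "open (QT T)" by (intro open_Times) auto
    have \<phi>t_zero: "\<phi>t z = 0" if "z \<in> QT T - C" for z
      unfolding \<phi>t_def by (rule frechet_derivative_zero_outside_support[OF QT_open C(1) C(3) that])
    have \<phi>_cont: "continuous_on B \<phi>" and \<phi>t_cont: "continuous_on B \<phi>t"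
      unfolding \<phi>t_def using Cc_infty_continuous_on[OF \<phi>] Cc_infty_continuous_on_derivative[OF \<phi>] B(2)
      by (auto intro: continuous_on_subset)
    have \<psi>_cont: "continuous_on B \<psi>"
      unfolding \<psi>_def by (intro continuous_intros \<phi>_cont \<phi>t_cont K_cont ballI) (use K_pos B(2) in force)
    have int_\<psi>: "integrable (lebesgue_on B) \<psi>"
      using continuous_imp_integrable[of "(p, \<alpha>)" "(q, \<gamma>)" \<psi>] \<psi>_cont by (simp add: B_def cbox_Pair_eq)
    have int_u: "integrable (lebesgue_on B) (\<lambda>z. u z * f z)" if "continuous_on B f" for f
      using integrable_mult_bounded(1)[OF assms(1) B(1,2) _ that] lim[OF B(1,2)] by (simp add: Lp_tendsto_def)
    have \<sigma>_ge1: "1 \<le> \<sigma> k" for k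
      using \<sigma> by (metis le0 order_trans strict_mono_less_eq)
    have \<sigma>_lim: "filterlim \<sigma> sequentially sequentially"
      using \<sigma>(1) by (rule filterlim_subseq)
    have ev_a: "\<forall>\<^sub>F k in sequentially. a (\<sigma> k) < \<alpha>"
    proof -
      have "a \<longlonglongrightarrow> 0" using adm by (simp add: admissible_data_def)
      then have "(\<lambda>k. a (\<sigma> k)) \<longlonglongrightarrow> 0" using \<sigma>_lim by (rule filterlim_compose)
      then show ?thesis using box(4) by (rule order_tendstoD)
    qed
    have ev_b: "\<forall>\<^sub>F k in sequentially. \<gamma> < b (\<sigma> k)"
    proof -
      have "filterlim b at_top sequentially" using adm by (simp add: admissible_data_def)
      then have "filterlim (\<lambda>k. b (\<sigma> k)) at_top sequentially" using \<sigma>_lim by (rule filterlim_compose)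
      then show ?thesis by (simp add: filterlim_at_top_dense)
    qed
    have ev_Lp: "\<forall>\<^sub>F k in sequentially. un (\<sigma> k) \<in> Lp 1 (restrict_space (dt_nu lam T) B)"
      using lim[OF B(1,2)] by (simp add: Lp_tendsto_def)
    have "\<forall>\<^sub>F k in sequentially.
        0 \<le> (LINT z|lebesgue_on B. un (\<sigma> k) z * \<psi> z) + 1 / real (\<sigma> k) * (LINT z|lebesgue_on B. \<psi> z)"
      using ev_a ev_b ev_Lp
    proof eventually_elim
      case (elim k)
      define n where "n = \<sigma> k"
      have n: "1 \<le> n" using \<sigma>_ge1 by (simp add: n_def)
      have data: "0 < a n" "a n < b n" "0 < \<beta> n" "(\<lambda>x. rho lam x * gn n x) \<in> Cc_infty {a n<..<b n}"
        "\<And>x. x \<in> \<Omega> \<Longrightarrow> 0 \<le> v0 n x"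
        "min (essinf (lebesgue_on \<Omega>) (\<lambda>x. ereal (rho lam x * g x))) 0
          \<le> essinf (lebesgue_on {a n<..<b n}) (\<lambda>x. ereal (rho lam x * gn n x))"
        using adm n unfolding admissible_data_def by blast+
      obtain M where M: "\<And>x. x \<in> {a n<..<b n} \<Longrightarrow> \<bar>rho lam x * gn n x\<bar> \<le> M"
        using Cc_infty_bounded[OF data(4)] by metis
      \<comment> \<open>Unlike \<open>M\<close>, the constant \<theta> does not depend on
        \<open>n\<close>, so the same \<open>K_theta\<close> appears along the subsequence.\<close>
      have lower: "- \<theta> \<le> rho lam x * gn n x" if "x \<in> {a n<..<b n}" for x
        unfolding \<theta>_def by (rule neg_theta_le[OF g data(4) that data(6)])
      obtain ut ux uxx where
        pp: "parabolic_problem T (a n) (b n) (1 / real n) M \<theta> (\<lambda>z. un n z + 1 / real n) ut ux uxx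
          (rho lam) (\<lambda>x. rho lam x * gn n x)"
        and ut: "continuous_on ({0..T} \<times> {a n..b n}) ut"
        using regularized_solution_parabolic_problem[OF sol[OF n] data(3) assms(1,2) data(1,2) n \<theta> data(5) M lower]
        by metis
      have "0 \<le> (LINT z|lebesgue_on B. (un n z + 1 / real n) * \<psi> z)"
        unfolding \<psi>_def B_def
      proof (rule parabolic_problem.integral_lower_bound[OF pp _ _ _ _ _ ut])
        show "((\<lambda>s. \<phi> (s, x)) has_real_derivative \<phi>t (t, x)) (at t)" if "(t, x) \<in> {p..q} \<times> {\<alpha>..\<gamma>}" for t x
          unfolding \<phi>t_def
        proof (rule differentiable_imp_DERIV_fst)
          show "\<phi> differentiable (at (t, x))"
            by (rule Cc_infty_differentiable[OF \<phi>]) (use that box in auto)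
        qed
        show "\<phi> (p, x) = 0 \<and> \<phi> (q, x) = 0" if "x \<in> {\<alpha>..\<gamma>}" for x
        proof -
          have "(p, x) \<in> QT T - C" "(q, x) \<in> QT T - C" using that box C_box by auto
          then show ?thesis using C(3) by blast
        qed
        show "0 \<le> \<phi> z" if "z \<in> {p..q} \<times> {\<alpha>..\<gamma>}" for z
        proof (rule \<phi>_nonneg)
          show "z \<in> QT T" using that box by auto
        qed
      qed (use elim box \<phi>_cont \<phi>t_cont in \<open>auto simp: B_def n_def\<close>)
      also have "\<dots> = (LINT z|lebesgue_on B. un n z * \<psi> z + 1 / real n * \<psi> z)"
        by (simp only: distrib_right)
      also have "\<dots> = (LINT z|lebesgue_on B. un n z * \<psi> z) + 1 / real n * (LINT z|lebesgue_on B. \<psi> z)"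
        using integrable_mult_bounded(1)[OF assms(1) B(1,2) elim(3) \<psi>_cont] int_\<psi>
        by (subst Bochner_Integration.integral_add) (auto simp: n_def)
      finally show ?case by (simp add: n_def)
    qed
    \<comment> \<open>The shift by \<open>1 / n\<close> contributes a multiple of one fixed integral
      and disappears.\<close>
    moreover have "(\<lambda>k. (LINT z|lebesgue_on B. un (\<sigma> k) z * \<psi> z) + 1 / real (\<sigma> k) * (LINT z|lebesgue_on B. \<psi> z))
        \<longlonglongrightarrow> (LINT z|lebesgue_on B. u z * \<psi> z) + 0 * (LINT z|lebesgue_on B. \<psi> z)"
      by (intro tendsto_intros Lp_tendsto_1_imp_integral_tendsto[OF assms(1) B(1,2) lim[OF B(1,2)] \<psi>_cont]
          filterlim_compose[OF lim_1_over_n \<sigma>_lim])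
    ultimately have "0 \<le> (LINT z|lebesgue_on B. u z * \<psi> z)"
      by (auto dest: tendsto_lowerbound)
    also have "\<dots> = (LINT z|lebesgue_on B. u z * (\<phi> z / K_theta \<theta> (fst z))) - (LINT z|lebesgue_on B. u z * \<phi>t z)"
    proof -
      have "continuous_on B (\<lambda>z. \<phi> z / K_theta \<theta> (fst z))"
        by (intro continuous_intros \<phi>_cont K_cont ballI) (use K_pos B(2) in force)
      then show ?thesis
        unfolding \<psi>_def right_diff_distrib
        by (intro Bochner_Integration.integral_diff int_u \<phi>t_cont)
    qed
    \<comment> \<open>Both \<phi> and its time derivative vanish outside \<open>C\<close>, so the
      integrals over \<open>B\<close> extend to the whole domain.\<close>
    also have "(LINT z|lebesgue_on B. u z * \<phi>t z) = (LINT z|lebesgue_on (QT T). u z * \<phi>t z)"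
      by (rule integral_lebesgue_on_subset[symmetric])
        (use B \<phi>t_zero in \<open>auto simp: borel_open QT_open lmeasurable_compact fmeasurableD\<close>)
    also have "(LINT z|lebesgue_on B. u z * (\<phi> z / K_theta \<theta> (fst z)))
        = (LINT z|lebesgue_on (QT T). u z * (\<phi> z / K_theta \<theta> (fst z)))"
      by (rule integral_lebesgue_on_subset[symmetric])
        (use B C(3) in \<open>auto simp: borel_open QT_open lmeasurable_compact fmeasurableD\<close>)
    also have "\<dots> = - (LINT z|lebesgue_on (QT T). (\<lambda>(t, x). - (u (t, x) / K_theta \<theta> t)) z * \<phi> z)"
      by (simp add: split_def flip: Bochner_Integration.integral_minus)
    finally show ?thesis by (simp add: \<phi>t_def)
  qed
  ultimately show ?thesis
    unfolding distr_deriv_ge_def \<theta>_def by blast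
qed

end
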